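(* Let $\lambda\in\mathbb{C}\setminus\{0,1\}$ and let $C\subset\mathbb{CP}^2$ be the smooth cubic in Weierstrass form defined by $$F(x,y,z)=yz^2-x(x-y)(x-\lambda y).$$ For $(t,s)\in\mathbb{C}^2$ let $B_{t,s}(x,y,z)$ be the $3\times 3$ linear matrix $$B_{t,s}=x\begin{bmatrix}0&0&1\\0&1&0\\1&0&0\end{bmatrix}+z\begin{bmatrix}0&1&0\\1&0&0\\0&0&0\end{bmatrix}+y\begin{bmatrix}\frac{3t^2-2t(1+\lambda)-(1-\lambda)^2}{4}&s&\frac{t-1-\lambda}{2}\\-s&-t&0\\\frac{t-1-\lambda}{2}&0&-1\end{bmatrix},$$ and let $E=\begin{bmatrix}0&1&0\\-1&0&0\\0&0&0\end{bmatrix}$. Then a complete set of pfaffian representations of $F$, up to equivalence, consists of three indecomposable representations and of a family of decomposable representations parametrized by the whole affine curve $\{s^2=t(t-1)(t-\lambda)\}$ (the affine part $F(t,1,s)=0$ of $C$). Precisely: (1) For $t\in\{0,1,\lambda\}$ the $6\times 6$ skew-symmetric matrix $$\begin{bmatrix}yE&B_{t,0}\\-B_{t,0}^{\,t}&0\end{bmatrix}$$ is an indecomposable pfaffian representation of $F$. Up to equivalence these are exactly three indecomposable pfaffian representations, and every indecomposable pfaffian representation of $F$ is equivalent to one of them. (2) For every $(t,s)\in\mathbb{C}^2$ with $s^2=t(t-1)(t-\lambda)$ the matrix $$\begin{bmatrix}0&B_{t,s}\\-B_{t,s}^{\,t}&0\end{bmatrix}$$ is a decomposable pfaffian representation of $F$,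 and every decomposable pfaffian representation of $F$ is equivalent to one of these. (Here $B^{\,t}$ in superscript position denotes the transpose of $B$.)
   Context: A pfaffian representation of $F$ (or of $C$) is a matrix $A(x,y,z)=xA_x+yA_y+zA_z$, where $A_x,A_y,A_z$ are skew-symmetric $6\times6$ complex matrices, such that $\det A=c\,F^2$ for some $0\ne c\in\mathbb{C}$ (equivalently, the Pfaffian of $A$ is a nonzero constant multiple of $F$). Two pfaffian representations $A,A'$ are equivalent if $A'=PAP^{t}$ (with $P^t$ the transpose) for some $P\in\mathrm{GL}_6(\mathbb{C})$. A $3\times 3$ determinantal representation of $F$ is a matrix $B=xB_x+yB_y+zB_z$ with $B_x,B_y,B_z\in \mathrm{M}_3(\mathbb{C})$ and $\det B=c\,F$ for some $0\neq c\in\mathbb{C}$. A pfaffian representation is decomposable if it is equivalent to one of the form $\begin{bmatrix}0&B\\-B^{t}&0\end{bmatrix}$ with $B$ a $3\times3$ determinantal representation of $F$, and indecomposable otherwise. *)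

theory Defs
  imports
    Complex_Main
    "Jordan_Normal_Form.Determinant"
begin

text \<open>
  Ternary forms and linear matrices in \<open>x, y, z\<close> are represented by their evaluation
  functions. Since the complex numbers are infinite, a polynomial identity such as
  \<open>det A = c F\<^sup>2\<close> is the same as the identity of values at all complex points.
\<close>

type_synonym tform = "complex \<Rightarrow> complex \<Rightarrow> complex \<Rightarrow> complex"
type_synonym mform = "complex \<Rightarrow> complex \<Rightarrow> complex \<Rightarrow> complex mat"

definition skew_mats :: "nat \<Rightarrow> complex mat set" where
  "skew_mats n = {A \<in> carrier_mat n n. transpose_mat A = - A}"

definition linear_matrix :: "complex mat set \<Rightarrow> mform \<Rightarrow> bool" where
  "linear_matrix S A \<longleftrightarrow>
     (\<exists>Ax \<in> S. \<exists>Ay \<in> S. \<exists>Az \<in> S. \<forall>x y z.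
        A x y z = x \<cdot>\<^sub>m Ax + y \<cdot>\<^sub>m Ay + z \<cdot>\<^sub>m Az)"

definition pfaffian_rep :: "tform \<Rightarrow> mform \<Rightarrow> bool" where
  "pfaffian_rep F A \<longleftrightarrow> linear_matrix (skew_mats 6) A \<and>
     (\<exists>c. c \<noteq> 0 \<and> (\<forall>x y z. det (A x y z) = c * (F x y z)\<^sup>2))"

definition determinantal_rep :: "tform \<Rightarrow> mform \<Rightarrow> bool" where
  "determinantal_rep F B \<longleftrightarrow> linear_matrix (carrier_mat 3 3) B \<and>
     (\<exists>c. c \<noteq> 0 \<and> (\<forall>x y z. det (B x y z) = c * F x y z))"

definition pf_equiv :: "mform \<Rightarrow> mform \<Rightarrow> bool" where
  "pf_equiv A A' \<longleftrightarrow>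
     (\<exists>P \<in> carrier_mat 6 6. invertible_mat P \<and>
        (\<forall>x y z. A' x y z = P * A x y z * transpose_mat P))"

definition skew_block :: "mform \<Rightarrow> mform \<Rightarrow> mform" where
  "skew_block S B x y z =
     four_block_mat (S x y z) (B x y z) (- transpose_mat (B x y z)) (0\<^sub>m 3 3)"

abbreviation zero_form :: mform where
  "zero_form \<equiv> \<lambda>x y z. 0\<^sub>m 3 3"

definition decomposable_rep :: "tform \<Rightarrow> mform \<Rightarrow> bool" where
  "decomposable_rep F A \<longleftrightarrow> pfaffian_rep F A \<and>
     (\<exists>B. determinantal_rep F B \<and> pf_equiv A (skew_block zero_form B))"

definition indecomposable_rep :: "tform \<Rightarrow> mform \<Rightarrow> bool" where
  "indecomposable_rep F A \<longleftrightarrow> pfaffian_rep F A \<and> \<not> decomposable_rep F A"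

definition weierstrass :: "complex \<Rightarrow> tform" where
  "weierstrass l x y z = y * z\<^sup>2 - x * (x - y) * (x - l * y)"

definition Bmat :: "complex \<Rightarrow> complex \<Rightarrow> complex \<Rightarrow> mform" where
  "Bmat l t s x y z =
     x \<cdot>\<^sub>m mat_of_rows_list 3
       [[0, 0, 1],
        [0, 1, 0],
        [1, 0, 0]]
   + z \<cdot>\<^sub>m mat_of_rows_list 3
       [[0, 1, 0],
        [1, 0, 0],
        [0, 0, 0]]
   + y \<cdot>\<^sub>m mat_of_rows_list 3
       [[(3 * t\<^sup>2 - 2 * t * (1 + l) - (1 - l)\<^sup>2) / 4, s, (t - 1 - l) / 2],
        [- s, - t, 0],
        [(t - 1 - l) / 2, 0, - 1]]"

definition Emat :: "complex mat" where
  "Emat = mat_of_rows_list 3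
     [[0, 1, 0],
      [- 1, 0, 0],
      [0, 0, 0]]"

definition indec_rep :: "complex \<Rightarrow> complex \<Rightarrow> mform" where
  "indec_rep l t = skew_block (\<lambda>x y z. y \<cdot>\<^sub>m Emat) (Bmat l t 0)"

definition dec_rep :: "complex \<Rightarrow> complex \<Rightarrow> complex \<Rightarrow> mform" where
  "dec_rep l t s = skew_block zero_form (Bmat l t s)"

end

theory Submission
  imports Defs "Jordan_Normal_Form.Char_Poly"
begin

text \<open>
  On the line \<open>y = 0\<close> the cubic is \<open>- x\<^sup>3\<close>, and it is smooth at \<open>(0, 0, 1)\<close>. Together these
  force the skew pencil \<open>x A\<^sub>x + z A\<^sub>z\<close> to be congruent to one fixed pencil: the endomorphism
  \<open>A\<^sub>x\<inverse> A\<^sub>z\<close> has vanishing cube and nonvanishing square. Hence only the coefficient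
  of \<open>y\<close> varies, modulo the stabilizer of the fixed pencil, which is \<open>SL\<^sub>2\<close> over
  \<open>\<complex>[\<epsilon>]/\<epsilon>\<^sup>3\<close>. Its unipotent part brings that coefficient to a shape depending on three
  scalars and a binary quadratic form \<open>(\<alpha>, \<beta>, \<delta>)\<close>. Comparing Pfaffians expresses the three
  scalars by a parameter \<open>t\<close> and gives \<open>\<beta>\<^sup>2 - \<alpha> \<delta> = t (t - 1) (t - \<lambda>)\<close>. The remaining group
  \<open>SL\<^sub>2(\<complex>)\<close> turns the quadratic form into \<open>(0, s, 0)\<close>, the decomposable case, or, when its
  discriminant vanishes, into \<open>(1, 0, 0)\<close>.

  A decomposable representation \<open>A\<close> admits an involution \<open>P\<close> with \<open>P A P\<^sup>t = - A\<close>. The form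
  \<open>(1, 0, 0)\<close> excludes such a \<open>P\<close>: it would commute with \<open>A\<^sub>z A\<^sub>x\<inverse>\<close> and
  \<open>A\<^sub>y A\<^sub>x\<inverse>\<close>, whose common commutant is too small. The same computation with two
  parameters \<open>t\<close>, \<open>t'\<close> separates the indecomposable representations.
\<close>

section \<open>Pfaffians of skew-symmetric matrices of size six\<close>

text \<open>The minors of this expansion again have the form \<open>mat n n\<close>, so repeated
  rewriting evaluates the explicit determinants of sizes 2, 3 and 4 below.\<close>

lemma det_mat_Suc:
  fixes g :: "nat \<Rightarrow> nat \<Rightarrow> 'a :: comm_ring_1"
  shows "det (mat (Suc n) (Suc n) (\<lambda>(i, j). g i j)) =
    (\<Sum>j<Suc n. (-1)^j * g 0 j * det (mat n n (\<lambda>(i, k). g (Suc i) (if k < j then k else Suc k))))"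
proof -
  have "mat_delete (mat (Suc n) (Suc n) (\<lambda>(i, j). g i j)) 0 j
     = mat n n (\<lambda>(i, k). g (Suc i) (if k < j then k else Suc k))" if "j < Suc n" for j
    using that by (auto simp: mat_delete_def)
  then show ?thesis
    by (subst laplace_expansion_row[where i = 0 and n = "Suc n"]) (auto simp: cofactor_def mult_ac intro!: sum.cong)
qed

text \<open>Only the values \<open>f i j\<close> with \<open>i < j < 6\<close> matter.\<close>

definition skew6 :: "(nat \<Rightarrow> nat \<Rightarrow> 'a :: comm_ring_1) \<Rightarrow> 'a mat" where
  "skew6 f = mat 6 6 (\<lambda>(i, j). if i < j then f i j else if j < i then - f j i else 0)"

definition pf4 :: "(nat \<Rightarrow> nat \<Rightarrow> 'a :: comm_ring_1) \<Rightarrow> nat \<Rightarrow> nat \<Rightarrow> nat \<Rightarrow> nat \<Rightarrow> 'a" where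
  "pf4 f i j k l = f i j * f k l - f i k * f j l + f i l * f j k"

definition pf6 :: "(nat \<Rightarrow> nat \<Rightarrow> 'a :: comm_ring_1) \<Rightarrow> 'a" where
  "pf6 f = f 0 1 * pf4 f 2 3 4 5 - f 0 2 * pf4 f 1 3 4 5 + f 0 3 * pf4 f 1 2 4 5
     - f 0 4 * pf4 f 1 2 3 5 + f 0 5 * pf4 f 1 2 3 4"

text \<open>The Pfaffian analogue of the adjugate: up to sign, the entry at \<open>(i, j)\<close> is
  the Pfaffian of the principal submatrix of size four that omits the indices \<open>i\<close> and
  \<open>j\<close>.\<close>

definition pf_adj :: "(nat \<Rightarrow> nat \<Rightarrow> 'a :: comm_ring_1) \<Rightarrow> 'a mat" where
  "pf_adj f = skew6 (\<lambda>i j. [[0, - pf4 f 2 3 4 5, pf4 f 1 3 4 5, - pf4 f 1 2 4 5, pf4 f 1 2 3 5, - pf4 f 1 2 3 4],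
     [0, 0, - pf4 f 0 3 4 5, pf4 f 0 2 4 5, - pf4 f 0 2 3 5, pf4 f 0 2 3 4],
     [0, 0, 0, - pf4 f 0 1 4 5, pf4 f 0 1 3 5, - pf4 f 0 1 3 4],
     [0, 0, 0, 0, - pf4 f 0 1 2 5, pf4 f 0 1 2 4],
     [0, 0, 0, 0, 0, - pf4 f 0 1 2 3]] ! i ! j)"

lemma skew6_carrier [simp]: "skew6 f \<in> carrier_mat 6 6" "dim_row (skew6 f) = 6" "dim_col (skew6 f) = 6"
  by (simp_all add: skew6_def)

lemma pf_adj_carrier [simp]: "pf_adj f \<in> carrier_mat 6 6" "dim_row (pf_adj f) = 6" "dim_col (pf_adj f) = 6"
  by (simp_all add: pf_adj_def)

lemma less6E:
  assumes "(i :: nat) < 6"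
  obtains "i = 0" | "i = 1" | "i = 2" | "i = 3" | "i = 4" | "i = 5"
  using assms by linarith

lemma sum_upto6: "(\<Sum>i = 0..<6. h i) = h 0 + h 1 + h 2 + h 3 + h 4 + h (5 :: nat)" for h :: "nat \<Rightarrow> 'a :: comm_monoid_add"
  by (simp add: numeral_eq_Suc sum.atLeast0_lessThan_Suc)

lemma skew6_mult_pf_adj: "skew6 f * pf_adj f = pf6 f \<cdot>\<^sub>m 1\<^sub>m 6"
proof (rule eq_matI)
  fix i j :: nat assume "i < dim_row (pf6 f \<cdot>\<^sub>m 1\<^sub>m 6)" "j < dim_col (pf6 f \<cdot>\<^sub>m 1\<^sub>m 6)"
  then have i: "i < 6" and j: "j < 6" by simp_all
  have 1: "(skew6 f * pf_adj f) $$ (i, j) = (\<Sum>k = 0..<6. skew6 f $$ (i, k) * pf_adj f $$ (k, j))"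
    using i j by (simp add: pf_adj_def scalar_prod_def)
  show "(skew6 f * pf_adj f) $$ (i, j) = (pf6 f \<cdot>\<^sub>m 1\<^sub>m 6) $$ (i, j)"
    using i j unfolding 1 sum_upto6
    by (elim less6E; simp add: skew6_def pf_adj_def pf6_def pf4_def; simp add: algebra_simps)
qed (simp_all add: pf_adj_def)

text \<open>Multiply \<open>skew6 f\<close> by the matrix \<open>X\<close> whose first two columns
  are those of \<open>pf_adj f\<close> and whose other columns are those of the identity. Both
  \<open>X\<close> and the product are block triangular. The corner \<open>Q\<close> of
  \<open>pf_adj f\<close> and the lower block \<open>T\<close> of \<open>skew6 f\<close> each have
  determinant \<open>(pf4 f 2 3 4 5)\<^sup>2\<close>, the latter by direct expansion in size
  four.\<close>

lemma det_skew6_aux: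
  "det (skew6 f) * (pf4 f 2 3 4 5)\<^sup>2 = (pf6 f)\<^sup>2 * (pf4 f 2 3 4 5)\<^sup>2" for f :: "nat \<Rightarrow> nat \<Rightarrow> 'a :: idom"
proof -
  define Q where "Q = mat 2 2 (\<lambda>(i, j). pf_adj f $$ (i, j))"
  define Q' where "Q' = mat 4 2 (\<lambda>(i, j). pf_adj f $$ (i + 2, j))"
  define S where "S = mat 2 4 (\<lambda>(i, j). skew6 f $$ (i, j + 2))"
  define T where "T = mat 4 4 (\<lambda>(i, j). skew6 f $$ (i + 2, j + 2))"
  define X where "X = four_block_mat Q (0\<^sub>m 2 4) Q' (1\<^sub>m 4)"
  have c: "Q \<in> carrier_mat 2 2" "Q' \<in> carrier_mat 4 2" "S \<in> carrier_mat 2 4" "T \<in> carrier_mat 4 4"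
    by (simp_all add: Q_def Q'_def S_def T_def)
  then have X: "X \<in> carrier_mat 6 6" unfolding X_def
    using four_block_carrier_mat[OF c(1), of "1\<^sub>m 4" 4 4] by simp
  have "skew6 f * X = four_block_mat (pf6 f \<cdot>\<^sub>m 1\<^sub>m 2) S (0\<^sub>m 4 2) T" (is "_ = ?R")
  proof (rule eq_matI)
    fix i j assume "i < dim_row ?R" "j < dim_col ?R"
    then have i: "i < 6" and j: "j < 6" by (auto simp: T_def)
    have 1: "(skew6 f * X) $$ (i, j) = (\<Sum>k = 0..<6. skew6 f $$ (i, k) * X $$ (k, j))"
      using i j X by (simp add: scalar_prod_def)
    show "(skew6 f * X) $$ (i, j) = ?R $$ (i, j)"
    proof (cases "j < 2")
      case True
      have "X $$ (k, j) = pf_adj f $$ (k, j)" if "k < 6" for k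
        using that True c by (cases "k < 2") (simp_all add: X_def Q_def Q'_def del: add_2_eq_Suc')
      then have "(skew6 f * X) $$ (i, j) = (skew6 f * pf_adj f) $$ (i, j)"
        unfolding 1 using i j True by (simp add: scalar_prod_def)
      with i j True show ?thesis by (simp add: skew6_mult_pf_adj T_def)
    next
      case False
      have "X $$ (k, j) = (if k = j then 1 else 0)" if "k < 6" for k
        using that j False c by (auto simp: X_def)
      then have "(skew6 f * X) $$ (i, j) = (\<Sum>k = 0..<6. if k = j then skew6 f $$ (i, k) else 0)"
        unfolding 1 by (intro sum.cong) auto
      then have "(skew6 f * X) $$ (i, j) = skew6 f $$ (i, j)"
        using j by simp
      also have "\<dots> = ?R $$ (i, j)"
        using i j False by (auto simp: S_def T_def simp del: add_2_eq_Suc')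
      finally show ?thesis .
    qed
  qed (use c X in auto)
  then have "det (skew6 f) * det X = det ?R"
    using det_mult[OF skew6_carrier(1) X, of f] by simp
  moreover have "det X = det Q * 1" 
    unfolding X_def by (subst det_four_block_mat_upper_right_zero[of _ 2 _ 4]) (use c in auto)
  moreover have "det Q = (pf4 f 2 3 4 5)\<^sup>2" 
  proof -
    have eq: "mat 2 2 = (mat (Suc (Suc 0)) (Suc (Suc 0)) :: _ \<Rightarrow> 'a mat)"
      by (simp add: numeral_eq_Suc)
    show ?thesis unfolding Q_def eq
      by (simp only: det_mat_Suc, simp add: skew6_def lessThan_Suc pf_adj_def power2_eq_square)
  qed
  moreover have "det ?R = det (pf6 f \<cdot>\<^sub>m 1\<^sub>m 2) * det T"
    by (subst det_four_block_mat_lower_left_zero[of _ 2 _ 4]) (use c in auto)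
  moreover have "det T = (pf4 f 2 3 4 5)\<^sup>2" 
  proof -
    have eq: "mat 4 4 = (mat (Suc (Suc (Suc (Suc 0)))) (Suc (Suc (Suc (Suc 0)))) :: _ \<Rightarrow> 'a mat)"
      by (simp add: numeral_eq_Suc)
    show ?thesis unfolding T_def eq
      by (simp only: det_mat_Suc, simp add: skew6_def lessThan_Suc pf4_def power2_eq_square numeral_eq_Suc, simp add: algebra_simps)
  qed
  ultimately show ?thesis by simp
qed

text \<open>
  Adding an indeterminate to two entries makes the factor \<open>pf4 f 2 3 4 5\<close> of the preceding
  identity nonzero, so that it can be cancelled.
\<close>

lemma det_skew6: "det (skew6 f) = (pf6 f)\<^sup>2" for f :: "nat \<Rightarrow> nat \<Rightarrow> 'a :: idom"
proof -
  define g where "g i j = (if (i, j) = (2, 3) \<or> (i, j) = (4, 5) then [:f i j, 1:] else [:f i j:])" for i j :: nat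
  have "pf4 g 2 3 4 5 = [:f 2 3, 1:] * [:f 4 5, 1:] - [:f 2 4 * f 3 5 - f 2 5 * f 3 4:]"
    by (simp add: pf4_def g_def)
  then have "coeff (pf4 g 2 3 4 5) 2 = 1"
    by (simp add: numeral_2_eq_2)
  then have "pf4 g 2 3 4 5 \<noteq> 0"
    by auto
  with det_skew6_aux[of g] have "det (skew6 g) = (pf6 g)\<^sup>2"
    by simp
  \<comment> \<open>Setting the indeterminate to 0 turns \<open>g\<close> back into
    \<open>f\<close>.\<close>
  then have "poly (det (skew6 g)) 0 = (poly (pf6 g) 0)\<^sup>2"
    by simp
  also have "poly (pf6 g) 0 = pf6 f"
    by (simp add: pf6_def pf4_def g_def mult_ac)
  also have "poly (det (skew6 g)) 0 = det (skew6 f)"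
    by (rule poly_det_cong[of _ 6]) (auto simp: skew6_def g_def)
  finally show ?thesis .
qed

section \<open>Congruence of skew matrices and equivalence of representations\<close>

text \<open>The alternating form with Gram matrix \<open>skew6 f\<close>. Vectors are functions, so
  that both a row of a matrix and a list lookup \<open>(!) p\<close> can be inserted.\<close>

definition bil :: "(nat \<Rightarrow> nat \<Rightarrow> complex) \<Rightarrow> (nat \<Rightarrow> complex) \<Rightarrow> (nat \<Rightarrow> complex) \<Rightarrow> complex" where
  "bil f v w = (\<Sum>a = 0..<6. \<Sum>b = 0..<6. v a * skew6 f $$ (a, b) * w b)"

text \<open>One summand for each of the fifteen free entries of \<open>f\<close>, multiplied by the
  corresponding Pluecker coordinate of the two vectors.\<close>

lemma bil_list:
  "bil f ((!) [a0, a1, a2, a3, a4, a5]) ((!) [b0, b1, b2, b3, b4, b5]) =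
    f 0 1 * (a0 * b1 - a1 * b0) + f 0 2 * (a0 * b2 - a2 * b0) + f 0 3 * (a0 * b3 - a3 * b0)
    + f 0 4 * (a0 * b4 - a4 * b0) + f 0 5 * (a0 * b5 - a5 * b0) + f 1 2 * (a1 * b2 - a2 * b1)
    + f 1 3 * (a1 * b3 - a3 * b1) + f 1 4 * (a1 * b4 - a4 * b1) + f 1 5 * (a1 * b5 - a5 * b1)
    + f 2 3 * (a2 * b3 - a3 * b2) + f 2 4 * (a2 * b4 - a4 * b2) + f 2 5 * (a2 * b5 - a5 * b2)
    + f 3 4 * (a3 * b4 - a4 * b3) + f 3 5 * (a3 * b5 - a5 * b3) + f 4 5 * (a4 * b5 - a5 * b4)"
  by (simp add: bil_def sum_upto6 skew6_def algebra_simps)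

definition mat6 :: "'a list list \<Rightarrow> 'a mat" where
  "mat6 L = mat 6 6 (\<lambda>(i, j). L ! i ! j)"

lemma mat6_carrier [simp]: "mat6 L \<in> carrier_mat 6 6" "dim_row (mat6 L) = 6" "dim_col (mat6 L) = 6"
  by (simp_all add: mat6_def)

lemma mat6_index: "i < 6 \<Longrightarrow> j < 6 \<Longrightarrow> mat6 L $$ (i, j) = L ! i ! j"
  by (simp add: mat6_def)

lemma skew6_transpose: "transpose_mat (skew6 f) = - skew6 f"
  by (rule eq_matI) (auto simp: skew6_def)

lemma skew6_eqI:
  "(\<And>i j. i < j \<Longrightarrow> j < 6 \<Longrightarrow> f i j = g i j) \<Longrightarrow> skew6 f = skew6 g"
  by (rule eq_matI) (auto simp: skew6_def)

lemma mat6_congruence_index: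
  assumes P: "P \<in> carrier_mat 6 6" and A: "A \<in> carrier_mat 6 6" and ij: "i < 6" "j < 6"
  shows "(P * A * transpose_mat P) $$ (i, j) = (\<Sum>a = 0..<6. \<Sum>b = 0..<6. P $$ (i, a) * A $$ (a, b) * P $$ (j, b))"
proof -
  have "(M * transpose_mat P) $$ (i, j) = (\<Sum>b = 0..<6. M $$ (i, b) * P $$ (j, b))" if "M \<in> carrier_mat 6 6" for M
    using that P ij by (simp add: scalar_prod_def)
  from this[OF mult_carrier_mat[OF P A]]
  have "(P * A * transpose_mat P) $$ (i, j) = (\<Sum>b = 0..<6. (P * A) $$ (i, b) * P $$ (j, b))" .
  also have "\<dots> = (\<Sum>b = 0..<6. \<Sum>a = 0..<6. P $$ (i, a) * A $$ (a, b) * P $$ (j, b))"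
    using assms by (simp add: scalar_prod_def sum_distrib_right)
  finally show ?thesis by (subst sum.swap)
qed

lemma bil_neg: "bil f v w = - bil f w v"
  unfolding bil_def
  by (subst sum.swap, unfold sum_negf[symmetric], intro sum.cong refl) (auto simp: skew6_def mult_ac)

lemma bil_self: "bil f v v = 0"
  using bil_neg[of f v v] by simp

lemma bil_linear: "bil (\<lambda>i j. x * a i j + y * b i j + z * c i j) v w = x * bil a v w + y * bil b v w + z * bil c v w"
proof -
  have "bil (\<lambda>i j. x * a i j + y * b i j + z * c i j) v w =
    (\<Sum>i = 0..<6. \<Sum>j = 0..<6. x * (v i * skew6 a $$ (i, j) * w j) + y * (v i * skew6 b $$ (i, j) * w j)
      + z * (v i * skew6 c $$ (i, j) * w j))"
    unfolding bil_def by (intro sum.cong refl) (auto simp: skew6_def algebra_simps)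
  then show ?thesis by (simp add: bil_def sum.distrib sum_distrib_left)
qed

lemma skew6_congruence:
  assumes P: "P \<in> carrier_mat 6 6"
  shows "P * skew6 f * transpose_mat P = skew6 (\<lambda>i j. bil f (\<lambda>a. P $$ (i, a)) (\<lambda>a. P $$ (j, a)))" (is "_ = skew6 ?g")
proof (rule eq_matI)
  fix i j assume "i < dim_row (skew6 ?g)" "j < dim_col (skew6 ?g)"
  then have ij: "i < 6" "j < 6" by simp_all
  have "(P * skew6 f * transpose_mat P) $$ (i, j) = ?g i j"
    using mat6_congruence_index[OF P skew6_carrier(1) ij] by (simp add: bil_def)
  with ij show "(P * skew6 f * transpose_mat P) $$ (i, j) = skew6 ?g $$ (i, j)"
    using bil_neg[of f "\<lambda>a. P $$ (i, a)" "\<lambda>a. P $$ (j, a)"]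
    by (cases i j rule: linorder_cases) (simp_all add: skew6_def bil_self)
qed (use P in auto)

text \<open>A congruence by an explicit matrix becomes fifteen scalar equations, each of which
  \<open>bil_list\<close> evaluates.\<close>

lemma mat6_congruence:
  assumes "bil f ((!) p0) ((!) p1) = g 0 1" "bil f ((!) p0) ((!) p2) = g 0 2" "bil f ((!) p0) ((!) p3) = g 0 3" "bil f ((!) p0) ((!) p4) = g 0 4" "bil f ((!) p0) ((!) p5) = g 0 5"
    "bil f ((!) p1) ((!) p2) = g 1 2" "bil f ((!) p1) ((!) p3) = g 1 3" "bil f ((!) p1) ((!) p4) = g 1 4" "bil f ((!) p1) ((!) p5) = g 1 5"
    "bil f ((!) p2) ((!) p3) = g 2 3" "bil f ((!) p2) ((!) p4) = g 2 4" "bil f ((!) p2) ((!) p5) = g 2 5"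
    "bil f ((!) p3) ((!) p4) = g 3 4" "bil f ((!) p3) ((!) p5) = g 3 5"
    "bil f ((!) p4) ((!) p5) = g 4 5"
  shows "mat6 [p0, p1, p2, p3, p4, p5] * skew6 f * transpose_mat (mat6 [p0, p1, p2, p3, p4, p5]) = skew6 g"
proof -
  have "skew6 (\<lambda>i j. bil f (\<lambda>a. mat6 [p0, p1, p2, p3, p4, p5] $$ (i, a)) (\<lambda>a. mat6 [p0, p1, p2, p3, p4, p5] $$ (j, a))) = skew6 g"
  proof (rule skew6_eqI)
    fix i j :: nat assume ij: "i < j" "j < 6"
    then have i: "i < 6" by simp
    from ij i have "bil f (\<lambda>a. mat6 [p0, p1, p2, p3, p4, p5] $$ (i, a)) (\<lambda>a. mat6 [p0, p1, p2, p3, p4, p5] $$ (j, a))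
        = bil f ((!) ([p0, p1, p2, p3, p4, p5] ! i)) ((!) ([p0, p1, p2, p3, p4, p5] ! j))"
      unfolding bil_def by (intro sum.cong refl) (simp add: mat6_index)
    also have "\<dots> = g i j"
      by (insert ij assms, rule less6E[OF i]; rule less6E[OF ij(2)]; simp)
    finally show "bil f (\<lambda>a. mat6 [p0, p1, p2, p3, p4, p5] $$ (i, a)) (\<lambda>a. mat6 [p0, p1, p2, p3, p4, p5] $$ (j, a)) = g i j" .
  qed
  then show ?thesis by (simp add: skew6_congruence)
qed

section \<open>Skew-symmetric linear matrices as pencils, and equivalence as an equivalence
  relation\<close>

lemma skew_mats_iff: "A \<in> skew_mats 6 \<longleftrightarrow> A = skew6 (\<lambda>i j. A $$ (i, j))"
proof
  assume "A \<in> skew_mats 6"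
  then have A: "A \<in> carrier_mat 6 6" and t: "transpose_mat A = - A"
    by (auto simp: skew_mats_def)
  have 1: "A $$ (j, i) = - A $$ (i, j)" if "i < 6" "j < 6" for i j
    using arg_cong[OF t, of "\<lambda>M. M $$ (i, j)"] that A by simp
  have 2: "A $$ (i, i) = 0" if "i < 6" for i
    using 1[OF that that] by simp
  show "A = skew6 (\<lambda>i j. A $$ (i, j))"
  proof (rule eq_matI)
    fix i j assume "i < dim_row (skew6 (\<lambda>i j. A $$ (i, j)))" "j < dim_col (skew6 (\<lambda>i j. A $$ (i, j)))"
    then show "A $$ (i, j) = skew6 (\<lambda>i j. A $$ (i, j)) $$ (i, j)"
      using 1[of j i] 2[of i] by (cases i j rule: linorder_cases) (simp_all add: skew6_def)
  qed (use A in auto)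
next
  assume "A = skew6 (\<lambda>i j. A $$ (i, j))"
  moreover have "skew6 (\<lambda>i j. A $$ (i, j)) \<in> skew_mats 6"
    by (simp add: skew_mats_def skew6_transpose)
  ultimately show "A \<in> skew_mats 6" by (rule ssubst)
qed

text \<open>The coefficients are entry functions under a single \<open>skew6\<close>, so
  skew-symmetry is built in and the Pfaffian can be read off as \<open>pf6\<close> of the combined
  entries.\<close>

definition pencil :: "(nat \<Rightarrow> nat \<Rightarrow> complex) \<Rightarrow> (nat \<Rightarrow> nat \<Rightarrow> complex) \<Rightarrow> (nat \<Rightarrow> nat \<Rightarrow> complex) \<Rightarrow> mform" where
  "pencil a b c x y z = skew6 (\<lambda>i j. x * a i j + y * b i j + z * c i j)"

lemma pencil_linear: "pencil a b c x y z = x \<cdot>\<^sub>m skew6 a + y \<cdot>\<^sub>m skew6 b + z \<cdot>\<^sub>m skew6 c"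
  by (rule eq_matI) (auto simp: pencil_def skew6_def algebra_simps)

lemma linear_skew_pencil: "linear_matrix (skew_mats 6) A \<longleftrightarrow> (\<exists>a b c. A = pencil a b c)"
proof
  assume "linear_matrix (skew_mats 6) A"
  then obtain X Y Z where s: "X \<in> skew_mats 6" "Y \<in> skew_mats 6" "Z \<in> skew_mats 6"
    and A: "\<And>x y z. A x y z = x \<cdot>\<^sub>m X + y \<cdot>\<^sub>m Y + z \<cdot>\<^sub>m Z"
    by (auto simp: linear_matrix_def)
  from s obtain a b c where "X = skew6 a" "Y = skew6 b" "Z = skew6 c"
    unfolding skew_mats_iff by metis
  with A have "A = pencil a b c"
    by (intro ext) (simp add: pencil_linear)
  then show "\<exists>a b c. A = pencil a b c" by blast
next
  assume "\<exists>a b c. A = pencil a b c"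
  moreover have "skew6 f \<in> skew_mats 6" for f :: "nat \<Rightarrow> nat \<Rightarrow> complex"
    by (simp add: skew_mats_def skew6_transpose)
  ultimately show "linear_matrix (skew_mats 6) A"
    unfolding linear_matrix_def by (force simp: pencil_linear)
qed

lemma det_pencil: "det (pencil a b c x y z) = (pf6 (\<lambda>i j. x * a i j + y * b i j + z * c i j))\<^sup>2"
  by (simp add: pencil_def det_skew6)

lemma invertible_mat_iff_det:
  assumes "P \<in> carrier_mat n n"
  shows "invertible_mat P \<longleftrightarrow> det P \<noteq> (0 :: 'a :: field)"
proof
  assume "invertible_mat P"
  then obtain Q where Q: "inverts_mat P Q" "inverts_mat Q P" by (auto simp: invertible_mat_def)
  then have PQ: "P * Q = 1\<^sub>m n" and QP: "Q * P = 1\<^sub>m (dim_row Q)" using assms by (auto simp: inverts_mat_def)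
  have "dim_row Q = n" using arg_cong[OF QP, of dim_col] assms by simp
  moreover have "dim_col Q = n" using arg_cong[OF PQ, of dim_col] by simp
  ultimately have "Q \<in> carrier_mat n n" by auto
  from arg_cong[OF PQ, of det] det_mult[OF assms this] show "det P \<noteq> 0" by auto
next
  assume "det P \<noteq> 0"
  from det_non_zero_imp_unit[OF assms this, of undefined] obtain Q where
    "Q \<in> carrier_mat n n" "Q * P = 1\<^sub>m n" "P * Q = 1\<^sub>m n"
    by (auto simp: Units_def ring_mat_def)
  with assms show "invertible_mat P"
    by (auto simp: invertible_mat_def inverts_mat_def)
qed

lemma pf_equiv_refl: 
  assumes "linear_matrix (skew_mats 6) A"
  shows "pf_equiv A A"
proof -
  from assms have "A x y z \<in> carrier_mat 6 6" for x y z
    by (auto simp: linear_skew_pencil pencil_def)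
  then have "A x y z = 1\<^sub>m 6 * A x y z * transpose_mat (1\<^sub>m 6)" for x y z
    using left_mult_one_mat[of "A x y z" 6 6] right_mult_one_mat[of "A x y z" 6 6] by simp
  then show ?thesis
    by (auto simp: pf_equiv_def invertible_mat_iff_det intro!: bexI[of _ "1\<^sub>m 6"])
qed

lemma pf_equiv_trans: 
  assumes A: "linear_matrix (skew_mats 6) A" and "pf_equiv A B" "pf_equiv B C"
  shows "pf_equiv A C"
proof -
  from A have A: "A x y z \<in> carrier_mat 6 6" for x y z
    by (auto simp: linear_skew_pencil pencil_def)
  from assms obtain P Q where P: "P \<in> carrier_mat 6 6" "invertible_mat P"
      and B: "\<And>x y z. B x y z = P * A x y z * transpose_mat P"
      and Q: "Q \<in> carrier_mat 6 6" "invertible_mat Q" 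
      and C: "\<And>x y z. C x y z = Q * B x y z * transpose_mat Q"
    by (auto simp: pf_equiv_def)
  have "C x y z = (Q * P) * A x y z * transpose_mat (Q * P)" for x y z
  proof -
    note [simp] = mult_carrier_mat[of _ 6 6 _ 6] transpose_mult[OF Q(1) P(1)] assoc_mult_mat[of _ 6 6 _ 6 _ 6]
    show ?thesis using A[of x y z] P Q unfolding B C by simp
  qed
  moreover have "invertible_mat (Q * P)" "Q * P \<in> carrier_mat 6 6"
    using P Q det_mult[OF Q(1) P(1)] by (auto simp: invertible_mat_iff_det[of _ 6])
  ultimately show ?thesis unfolding pf_equiv_def by blast
qed

lemma pf_equiv_sym: 
  assumes A: "linear_matrix (skew_mats 6) A" and "pf_equiv A B"
  shows "pf_equiv B A"
proof -
  from A have A: "A x y z \<in> carrier_mat 6 6" for x y z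
    by (auto simp: linear_skew_pencil pencil_def)
  from assms obtain P where P: "P \<in> carrier_mat 6 6" "det P \<noteq> 0"
      and B: "\<And>x y z. B x y z = P * A x y z * transpose_mat P"
    by (auto simp: pf_equiv_def invertible_mat_iff_det)
  from det_non_zero_imp_unit[OF P, of undefined] obtain Q where
    Q: "Q \<in> carrier_mat 6 6" "Q * P = 1\<^sub>m 6" 
    by (auto simp: Units_def ring_mat_def)
  have t: "transpose_mat P * transpose_mat Q = 1\<^sub>m 6"
    using transpose_mult[OF Q(1) P(1)] Q(2) by simp
  have "A x y z = Q * B x y z * transpose_mat Q" for x y z
  proof -
    have "Q * B x y z * transpose_mat Q = (Q * P) * A x y z * (transpose_mat P * transpose_mat Q)"
      unfolding B using A[of x y z] P Q(1) by (simp add: mult_carrier_mat[of _ 6 6 _ 6] assoc_mult_mat[of _ 6 6 _ 6 _ 6])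
    with Q t A[of x y z] show ?thesis
      using left_mult_one_mat[of "A x y z" 6 6] right_mult_one_mat[of "A x y z" 6 6] by simp
  qed
  moreover have "invertible_mat Q"
    using det_mult[OF Q(1) P(1)] Q by (auto simp: invertible_mat_iff_det[of _ 6])
  ultimately show ?thesis using Q unfolding pf_equiv_def by blast
qed

lemma pf_equiv_pencil:
  assumes P: "P \<in> carrier_mat 6 6" "invertible_mat P"
  defines "g f \<equiv> \<lambda>i j. bil f (\<lambda>a. P $$ (i, a)) (\<lambda>a. P $$ (j, a))"
  shows "pf_equiv (pencil a b c) (pencil (g a) (g b) (g c))"
proof -
  have "pencil (g a) (g b) (g c) x y z = P * pencil a b c x y z * transpose_mat P" for x y z
    by (simp add: pencil_def skew6_congruence[OF P(1)] g_def bil_linear)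
  with P show ?thesis unfolding pf_equiv_def by blast
qed

lemma pfaffian_rep_equiv:
  assumes "pfaffian_rep F A" "pf_equiv A B"
  shows "pfaffian_rep F B"
proof -
  from assms obtain a b c k where A: "A = pencil a b c" and k: "k \<noteq> 0"
    "\<And>x y z. det (A x y z) = k * (F x y z)\<^sup>2"
    by (auto simp: pfaffian_rep_def linear_skew_pencil)
  from assms obtain P where P: "P \<in> carrier_mat 6 6" "det P \<noteq> 0" "invertible_mat P"
      and B: "\<And>x y z. B x y z = P * A x y z * transpose_mat P"
    by (auto simp: pf_equiv_def invertible_mat_iff_det)
  have Ac: "A x y z \<in> carrier_mat 6 6" for x y z
    by (simp add: A pencil_def)
  have "B = pencil (\<lambda>i j. bil a (\<lambda>a. P $$ (i, a)) (\<lambda>a. P $$ (j, a))) (\<lambda>i j. bil b (\<lambda>a. P $$ (i, a)) (\<lambda>a. P $$ (j, a)))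
    (\<lambda>i j. bil c (\<lambda>a. P $$ (i, a)) (\<lambda>a. P $$ (j, a)))"
    by (intro ext) (simp add: B A pencil_def skew6_congruence[OF P(1)] bil_linear)
  moreover have "det (B x y z) = (k * (det P)\<^sup>2) * (F x y z)\<^sup>2" for x y z
    unfolding B using Ac[of x y z] P(1) k(2)[of x y z]
    by (simp add: det_mult[of _ 6] mult_carrier_mat[of _ 6 6 _ 6] det_transpose[of _ 6] power2_eq_square)
  ultimately show ?thesis using k(1) P(2)
    unfolding pfaffian_rep_def linear_skew_pencil by (metis mult_eq_0_iff power_not_zero)
qed

section \<open>The pencil on the line $y = 0$\<close>

lemma cubic_eq_coeffs:
  fixes p0 :: "'a :: {idom, ring_char_0}"
  assumes "\<And>x. p0 + p1 * x + p2 * x^2 + p3 * x^3 = q0 + q1 * x + q2 * x^2 + q3 * x^3"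
  shows "p0 = q0" "p1 = q1" "p2 = q2" "p3 = q3"
proof -
  have "poly [:p0, p1, p2, p3:] x = poly [:q0, q1, q2, q3:] x" for x
    using assms[of x] by (simp add: algebra_simps power2_eq_square power3_eq_cube)
  then have "[:p0, p1, p2, p3:] = [:q0, q1, q2, q3:]"
    by (intro iffD1[OF poly_eq_poly_eq_iff] ext)
  then show "p0 = q0" "p1 = q1" "p2 = q2" "p3 = q3" by simp_all
qed

text \<open>A determinant yields only the square of a Pfaffian. Polynomials over a domain form a
  domain, so equal squares leave one global sign rather than a sign that varies with the
  point.\<close>

lemma cubic_square_eq:
  fixes p0 :: "'a :: {idom, ring_char_0}"
  assumes "\<And>x. (p0 + p1 * x + p2 * x^2 + p3 * x^3)^2 = (q0 + q1 * x + q2 * x^2 + q3 * x^3)^2"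
  shows "(p0 = q0 \<and> p1 = q1 \<and> p2 = q2 \<and> p3 = q3) \<or> (p0 = - q0 \<and> p1 = - q1 \<and> p2 = - q2 \<and> p3 = - q3)"
proof -
  have "poly ([:p0, p1, p2, p3:]^2) x = poly ([:q0, q1, q2, q3:]^2) x" for x
    using assms[of x] by (simp add: algebra_simps power2_eq_square power3_eq_cube)
  then have "[:p0, p1, p2, p3:]^2 = [:q0, q1, q2, q3:]^2"
    by (intro iffD1[OF poly_eq_poly_eq_iff] ext)
  then show ?thesis unfolding power2_eq_iff by simp
qed

text \<open>These are the coefficients of \<open>x\<close> in \<open>skew6_mult_pf_adj\<close> for
  the entries \<open>x f + g\<close>. As \<open>pf_adj\<close> is quadratic in the entries, its
  middle coefficient \<open>Q1\<close> is the polarization of \<open>pf_adj\<close> at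
  \<open>f\<close> and \<open>g\<close>.\<close>

lemma pf_adj_pencil:
  fixes f g :: "nat \<Rightarrow> nat \<Rightarrow> complex"
  obtains Q1 p0 p1 p2 p3 where "Q1 \<in> carrier_mat 6 6"
    "\<And>x. pf6 (\<lambda>i j. x * f i j + g i j) = p0 + p1 * x + p2 * x^2 + p3 * x^3"
    "skew6 g * pf_adj g = p0 \<cdot>\<^sub>m 1\<^sub>m 6"
    "skew6 g * Q1 + skew6 f * pf_adj g = p1 \<cdot>\<^sub>m 1\<^sub>m 6"
    "skew6 g * pf_adj f + skew6 f * Q1 = p2 \<cdot>\<^sub>m 1\<^sub>m 6"
    "skew6 f * pf_adj f = p3 \<cdot>\<^sub>m 1\<^sub>m 6"
proof -
  define h where "h x = (\<lambda>i j. x * f i j + g i j)" for x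
  define Q1 where "Q1 = pf_adj (h 1) - pf_adj g - pf_adj f"
  define E0 where "E0 = skew6 g * pf_adj g"
  define E1 where "E1 = skew6 g * Q1 + skew6 f * pf_adj g"
  define E2 where "E2 = skew6 g * pf_adj f + skew6 f * Q1"
  define E3 where "E3 = skew6 f * pf_adj f"
  have Q1: "Q1 \<in> carrier_mat 6 6" by (auto simp: Q1_def)
  have h: "skew6 (h x) $$ (i, j) = x * skew6 f $$ (i, j) + skew6 g $$ (i, j)" if "i < 6" "j < 6" for x i j
    using that by (auto simp: skew6_def h_def)
  have pf4: "pf4 (h x) i j k m = pf4 g i j k m + x * (pf4 (h 1) i j k m - pf4 g i j k m - pf4 f i j k m) + x^2 * pf4 f i j k m" for x i j k m
    by (simp add: pf4_def h_def algebra_simps power2_eq_square)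
  have a: "pf_adj (h x) $$ (i, j) = pf_adj g $$ (i, j) + x * Q1 $$ (i, j) + x^2 * pf_adj f $$ (i, j)"
    if "i < 6" "j < 6" for x i j
    using that unfolding Q1_def
    by (elim less6E; simp add: pf_adj_def skew6_def; subst pf4; simp add: algebra_simps)
  have e: "E0 $$ (i, j) + E1 $$ (i, j) * x + E2 $$ (i, j) * x^2 + E3 $$ (i, j) * x^3 = (if i = j then pf6 (h x) else 0)"
    if ij: "i < 6" "j < 6" for x i j
  proof -
    have "(if i = j then pf6 (h x) else 0) = (skew6 (h x) * pf_adj (h x)) $$ (i, j)"
      using ij by (simp add: skew6_mult_pf_adj)
    also have "\<dots> = (\<Sum>k = 0..<6. skew6 (h x) $$ (i, k) * pf_adj (h x) $$ (k, j))"
      using ij by (simp add: scalar_prod_def)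
    also have "\<dots> = (\<Sum>k = 0..<6. skew6 g $$ (i, k) * pf_adj g $$ (k, j)
       + (skew6 g $$ (i, k) * Q1 $$ (k, j) + skew6 f $$ (i, k) * pf_adj g $$ (k, j)) * x
       + (skew6 g $$ (i, k) * pf_adj f $$ (k, j) + skew6 f $$ (i, k) * Q1 $$ (k, j)) * x^2
       + (skew6 f $$ (i, k) * pf_adj f $$ (k, j)) * x^3)"
      using ij by (intro sum.cong refl) (simp add: h a algebra_simps power2_eq_square power3_eq_cube)
    also have "\<dots> = E0 $$ (i, j) + E1 $$ (i, j) * x + E2 $$ (i, j) * x^2 + E3 $$ (i, j) * x^3"
      using ij Q1 by (simp add: E0_def E1_def E2_def E3_def scalar_prod_def sum.distrib sum_distrib_right distrib_right)
    finally show ?thesis by simp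
  qed
  define e0 where "e0 = E0 $$ (0, 0)"
  define e1 where "e1 = E1 $$ (0, 0)"
  define e2 where "e2 = E2 $$ (0, 0)"
  define e3 where "e3 = E3 $$ (0, 0)"
  have p: "pf6 (h x) = e0 + e1 * x + e2 * x^2 + e3 * x^3" for x
    using e[of 0 0 x] by (simp add: e0_def e1_def e2_def e3_def)
  have c: "E0 \<in> carrier_mat 6 6" "E1 \<in> carrier_mat 6 6" "E2 \<in> carrier_mat 6 6" "E3 \<in> carrier_mat 6 6"
    using Q1 by (auto simp: E0_def E1_def E2_def E3_def)
  have *: "E0 $$ (i, j) = e0 * (if i = j then 1 else 0)" "E1 $$ (i, j) = e1 * (if i = j then 1 else 0)"
     "E2 $$ (i, j) = e2 * (if i = j then 1 else 0)" "E3 $$ (i, j) = e3 * (if i = j then 1 else 0)"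
    if ij: "i < 6" "j < 6" for i j
  proof -
    have "E0 $$ (i, j) + E1 $$ (i, j) * x + E2 $$ (i, j) * x^2 + E3 $$ (i, j) * x^3 =
      e0 * (if i = j then 1 else 0) + e1 * (if i = j then 1 else 0) * x
       + e2 * (if i = j then 1 else 0) * x^2 + e3 * (if i = j then 1 else 0) * x^3" for x
      using e[OF ij, of x] by (auto simp: p)
    from cubic_eq_coeffs[OF this] show "E0 $$ (i, j) = e0 * (if i = j then 1 else 0)" "E1 $$ (i, j) = e1 * (if i = j then 1 else 0)"
     "E2 $$ (i, j) = e2 * (if i = j then 1 else 0)" "E3 $$ (i, j) = e3 * (if i = j then 1 else 0)" .
  qed
  have "E0 = e0 \<cdot>\<^sub>m 1\<^sub>m 6" "E1 = e1 \<cdot>\<^sub>m 1\<^sub>m 6" 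
    "E2 = e2 \<cdot>\<^sub>m 1\<^sub>m 6" "E3 = e3 \<cdot>\<^sub>m 1\<^sub>m 6" 
    using c by (auto intro!: eq_matI simp: *)
  from that[OF Q1 p[unfolded h_def] this[unfolded E0_def E1_def E2_def E3_def]] show ?thesis
    by (simp add: E0_def E1_def E2_def E3_def)
qed

text \<open>
  The indices \<open>0, 1, 2\<close> and \<open>3, 4, 5\<close> stand for vectors \<open>e, \<epsilon> e, \<epsilon>\<^sup>2 e\<close> and
  \<open>f, \<epsilon> f, \<epsilon>\<^sup>2 f\<close>.
\<close>

definition hx :: "nat \<Rightarrow> nat \<Rightarrow> complex" where
  "hx i j = (if (i, j) \<in> {(0, 5), (1, 4), (2, 3)} then 1 else 0)"

text \<open>The form \<open>hx\<close> pairs \<open>\<epsilon>\<^sup>i e\<close> with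
  \<open>\<epsilon>\<^sup>j f\<close> to 1 exactly if \<open>i + j = 2\<close>, and
  \<open>hz\<close> exactly if \<open>i + j = 1\<close>. Thus \<open>hz\<close> arises from
  \<open>hx\<close> by applying \<epsilon> to one argument.\<close>

definition hz :: "nat \<Rightarrow> nat \<Rightarrow> complex" where
  "hz i j = (if (i, j) \<in> {(0, 4), (1, 3)} then 1 else 0)"

lemma pf6_hx: "pf6 hx = 1"
  by (simp add: pf6_def pf4_def hx_def)

text \<open>The Gram block is Hankel and encodes the unit
  \<open>s2 + s1 \<epsilon> + s0 \<epsilon>\<^sup>2\<close> modulo
  \<open>\<epsilon>\<^sup>3\<close>. Its inverse is
  \<open>k (1 + u \<epsilon> + v \<epsilon>\<^sup>2)\<close>; multiplying the second generator by
  this inverse normalizes both forms at once.\<close>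

lemma hankel_gram_normalize:
  fixes s0 s1 s2 :: complex
  assumes "s2 \<noteq> 0"
  defines "g0 \<equiv> \<lambda>i j. [[0, 0, 0, s0, s1, s2], [0, 0, 0, s1, s2, 0], [0, 0, 0, s2, 0, 0], replicate 6 0, replicate 6 0] ! i ! j"
    and "g1 \<equiv> \<lambda>i j. [[0, 0, 0, s1, s2, 0], [0, 0, 0, s2, 0, 0], replicate 6 0, replicate 6 0, replicate 6 0] ! i ! j"
  obtains P where "P \<in> carrier_mat 6 6"
    "P * skew6 g0 * transpose_mat P = skew6 hx" "P * skew6 g1 * transpose_mat P = skew6 hz"
proof -
  define k where "k = 1 / s2"
  define u where "u = - s1 / s2"
  define v where "v = - (s0 + u * s1) / s2"
  define P where "P = mat6 [[1, 0, 0, 0, 0, 0], [0, 1, 0, 0, 0, 0], [0, 0, 1, 0, 0, 0],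
    [0, 0, 0, k, k * u, k * v], [0, 0, 0, 0, k, k * u], [0, 0, 0, 0, 0, k]]"
  note kuv = k_def u_def v_def assms(1) field_simps
  have "P * skew6 g0 * transpose_mat P = skew6 hx"
    unfolding P_def by (rule mat6_congruence; simp add: bil_list g0_def hx_def; simp add: kuv)
  moreover have "P * skew6 g1 * transpose_mat P = skew6 hz"
    unfolding P_def by (rule mat6_congruence; simp add: bil_list g1_def hz_def; simp add: kuv)
  ultimately show ?thesis using that[of P] by (simp add: P_def)
qed


lemma pencil_congruence:
  assumes P: "P \<in> carrier_mat 6 6" and "det P \<noteq> 0"
    and "P * skew6 a * transpose_mat P = skew6 a'" "P * skew6 b * transpose_mat P = skew6 b'"
    "P * skew6 c * transpose_mat P = skew6 c'"
  shows "pf_equiv (pencil a b c) (pencil a' b' c')"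
proof -
  let ?g = "\<lambda>f i j. bil f (\<lambda>a. P $$ (i, a)) (\<lambda>a. P $$ (j, a))"
  have "pf_equiv (pencil a b c) (pencil (?g a) (?g b) (?g c))"
    using assms by (intro pf_equiv_pencil) (simp_all add: invertible_mat_iff_det)
  also have "pencil (?g a) (?g b) (?g c) = pencil a' b' c'"
    using assms(3-) by (intro ext) (simp add: pencil_linear skew6_congruence[OF P])
  finally show ?thesis .
qed

text \<open>The target \<open>skew6 hx\<close> has determinant 1, hence no factor of the left-hand
  side can be singular.\<close>

lemma congruence_to_hx_det:
  assumes P: "P \<in> carrier_mat 6 6" and "P * skew6 a * transpose_mat P = skew6 hx"
  shows "det P \<noteq> 0"
proof -
  have "det (P * skew6 a * transpose_mat P) = det P * det (skew6 a) * det P"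
    using P by (simp add: det_mult[of _ 6] det_transpose[of _ 6])
  with assms(2) have "det P * det (skew6 a) * det P = 1"
    by (simp add: det_skew6 pf6_hx)
  then show ?thesis by auto
qed

lemma mat_add_eq_zeroD:
  assumes "A + B = 0\<^sub>m n m" "A \<in> carrier_mat n m" "B \<in> carrier_mat n m"
  shows "B = - (A :: 'a :: group_add mat)"
proof (rule eq_matI)
  fix i j assume "i < dim_row (- A)" "j < dim_col (- A)"
  with assms(2,3) arg_cong[OF assms(1), of "\<lambda>M. M $$ (i, j)"] show "B $$ (i, j) = (- A) $$ (i, j)"
    by (simp add: eq_neg_iff_add_eq_0 minus_unique)
qed (use assms in auto)

text \<open>
  Comparing coefficients of \<open>x\<close> in \<open>(Z + x X) adj (Z + x X) = pf (Z + x X)\<close> shows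
  \<open>N\<^sup>3 = 0\<close> for \<open>N = Z X\<inverse>\<close>, and \<open>N\<^sup>2 = 0\<close> would contradict the linear term of the
  second hypothesis. The new basis consists of rows \<open>i\<close> and \<open>j\<close> of \<open>1, N, N\<^sup>2\<close>, where
  \<open>(N\<^sup>2 X)\<^sub>i\<^sub>j \<noteq> 0\<close>.
\<close>

lemma nilpotent_pencil_normal_form:
  assumes ac: "\<And>x. (pf6 (\<lambda>i j. x * a i j + c i j))\<^sup>2 = k * x ^ 6"
    and bc: "\<And>y. (pf6 (\<lambda>i j. y * b i j + c i j))\<^sup>2 = k * y ^ 2" and k: "k \<noteq> 0"
  obtains P where "P \<in> carrier_mat 6 6"
    "P * skew6 a * transpose_mat P = skew6 hx" "P * skew6 c * transpose_mat P = skew6 hz"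
proof -
  note [simp] = mult_carrier_mat[of _ 6 6 _ 6] assoc_mult_mat[of _ 6 6 _ 6 _ 6]
  define r where "r = csqrt k"
  have r: "r \<noteq> 0" "r\<^sup>2 = k" using k by (auto simp: r_def)
  define X where "X = skew6 a"
  define Z where "Z = skew6 c"
  have X: "X \<in> carrier_mat 6 6" and Z: "Z \<in> carrier_mat 6 6" by (simp_all add: X_def Z_def)
  obtain Q1 p0 p1 p2 p3 where Q1: "Q1 \<in> carrier_mat 6 6"
    and p: "\<And>x. pf6 (\<lambda>i j. x * a i j + c i j) = p0 + p1 * x + p2 * x^2 + p3 * x^3"
    and E: "skew6 c * pf_adj c = p0 \<cdot>\<^sub>m 1\<^sub>m 6" "skew6 c * Q1 + skew6 a * pf_adj c = p1 \<cdot>\<^sub>m 1\<^sub>m 6"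
      "skew6 c * pf_adj a + skew6 a * Q1 = p2 \<cdot>\<^sub>m 1\<^sub>m 6" "skew6 a * pf_adj a = p3 \<cdot>\<^sub>m 1\<^sub>m 6"
    by (rule pf_adj_pencil[of a c]) (rule that)
  note E = E[folded X_def Z_def]
  have "(p0 + p1 * x + p2 * x^2 + p3 * x^3)\<^sup>2 = (0 + 0 * x + 0 * x^2 + r * x^3)\<^sup>2" for x
    unfolding p[symmetric] ac by (simp add: power_mult_distrib r(2))
  from cubic_square_eq[OF this] r have p0: "p0 = 0" "p1 = 0" "p2 = 0" "p3 \<noteq> 0" by auto
  \<comment> \<open>If \<open>pf_adj c\<close> were zero, the linear coefficient in \<open>y\<close>
    of the second pencil would give \<open>Z * R = q1\<close> with nonzero \<open>q1\<close>. Then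
    \<open>Z\<close> would be invertible, although the first hypothesis at \<open>x = 0\<close> says
    \<open>det Z = 0\<close>.\<close>
  have c0: "pf_adj c \<noteq> 0\<^sub>m 6 6"
  proof
    assume 0: "pf_adj c = 0\<^sub>m 6 6"
    obtain R q0 q1 q2 q3 where R: "R \<in> carrier_mat 6 6"
      and q: "\<And>y. pf6 (\<lambda>i j. y * b i j + c i j) = q0 + q1 * y + q2 * y^2 + q3 * y^3"
      and ER: "skew6 c * R + skew6 b * pf_adj c = q1 \<cdot>\<^sub>m 1\<^sub>m 6"
      by (rule pf_adj_pencil[of b c]) (rule that)
    note ER = ER[folded Z_def]
    have "(q0 + q1 * y + q2 * y^2 + q3 * y^3)\<^sup>2 = (0 + r * y + 0 * y^2 + 0 * y^3)\<^sup>2" for y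
        unfolding q[symmetric] bc by (simp add: power_mult_distrib r(2))
    from cubic_square_eq[OF this] r have q1: "q1 \<noteq> 0" by auto
    have "Z * R = q1 \<cdot>\<^sub>m 1\<^sub>m 6" using ER R Z 0 by simp
    then have "det Z * det R = q1 ^ 6" using det_mult[OF Z R] by simp
    moreover have "det Z = 0" using ac[of 0] by (simp add: Z_def det_skew6)
    ultimately show False using q1 by simp
  qed
  \<comment> \<open>The inverse of \<open>X\<close> is \<open>Y\<close>, and the inverse of
    \<open>W\<close> is \<open>V\<close>, because \<open>X * W\<close> is the nonzero scalar
    \<open>p3\<close>.\<close>
  define W where "W = pf_adj a"
  define Y where "Y = (1 / p3) \<cdot>\<^sub>m W"
  define V where "V = (1 / p3) \<cdot>\<^sub>m X"
  have Y: "Y \<in> carrier_mat 6 6" and W: "W \<in> carrier_mat 6 6" and V: "V \<in> carrier_mat 6 6"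
    using X by (simp_all add: Y_def W_def V_def)
  have XW: "X * W = p3 \<cdot>\<^sub>m 1\<^sub>m 6" using E(4) by (simp add: W_def)
  have 1: "(1 / p3) \<cdot>\<^sub>m (p3 \<cdot>\<^sub>m 1\<^sub>m 6) = 1\<^sub>m 6"
    using p0 by (intro eq_matI) auto
  have XY: "X * Y = 1\<^sub>m 6"
    unfolding Y_def mult_smult_distrib[OF X W] XW 1 ..
  have YX: "Y * X = 1\<^sub>m 6"
    by (rule mat_mult_left_right_inverse[OF X Y XY])
  have VW: "V * W = 1\<^sub>m 6"
    unfolding V_def mult_smult_assoc_mat[OF X W] XW 1 ..
  have WV: "W * V = 1\<^sub>m 6"
    by (rule mat_mult_left_right_inverse[OF V W VW])
  have XYM: "X * (Y * M) = M" and YXM: "Y * (X * M) = M" if M: "M \<in> carrier_mat 6 6" for M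
    using M left_mult_one_mat[OF M] by (simp_all add: assoc_mult_mat[OF X Y M, symmetric] assoc_mult_mat[OF Y X M, symmetric] XY YX)
  have inv: "M = - (Y * N)" if "N + X * M = 0\<^sub>m 6 6" "N \<in> carrier_mat 6 6" "M \<in> carrier_mat 6 6" for M N
  proof -
    have "X * M = - N" using that X by (intro mat_add_eq_zeroD) auto
    then have "Y * (X * M) = Y * (- N)" by simp
    with that Y show ?thesis by (simp add: YXM)
  qed
  have z: "0 \<cdot>\<^sub>m 1\<^sub>m 6 = (0\<^sub>m 6 6 :: complex mat)" by (rule eq_matI) auto
  \<comment> \<open>The coefficient equations are solved downwards from the top degree: first for
    \<open>Q1\<close>, then for \<open>pf_adj c\<close>. The constant term finally says that
    \<open>Z Y Z Y Z\<close> vanishes, which is \<open>N^3 X = 0\<close> for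
    \<open>N = Z Y\<close>.\<close>
  have Q1': "Q1 = - (Y * (Z * W))"
    using E(3) p0 Z W Q1 by (intro inv) (simp_all add: W_def z)
  have c: "pf_adj c = - (Y * (Z * Q1))"
    using E(2) p0 Z W Q1 by (intro inv) (simp_all add: z)
  also have "\<dots> = Y * (Z * (Y * (Z * W)))"
    unfolding Q1' using Y Z W by simp
  finally have c: "pf_adj c = Y * (Z * (Y * (Z * W)))" .
  have "Z * (Y * (Z * (Y * (Z * W)))) = 0\<^sub>m 6 6"
    using E(1) p0 by (simp add: c z)
  then have "(Z * (Y * (Z * (Y * (Z * W))))) * V = 0\<^sub>m 6 6"
    using V by simp
  then have Z5: "Z * (Y * (Z * (Y * Z))) = 0\<^sub>m 6 6"
    using Z Y W V WV by simp
  have "Z * (Y * Z) \<noteq> 0\<^sub>m 6 6"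
  proof
    assume 0: "Z * (Y * Z) = 0\<^sub>m 6 6"
    have "Z * (Y * (Z * W)) = (Z * (Y * Z)) * W" using Z Y W by simp
    with 0 W Y c have "pf_adj c = 0\<^sub>m 6 6" by simp
    with c0 show False by simp
  qed
  moreover have ZYZ: "Z * (Y * Z) \<in> carrier_mat 6 6" using Z Y by simp
  ultimately obtain i j where ij: "i < 6" "j < 6" "(Z * (Y * Z)) $$ (i, j) \<noteq> 0"
    by (metis (no_types, lifting) carrier_matD eq_matI index_zero_mat)
  define N where "N = Z * Y"
  have N: "N \<in> carrier_mat 6 6" using Z Y by (simp add: N_def)
  have tZ: "transpose_mat Z = - Z" and tY: "transpose_mat Y = - Y"
    unfolding Z_def Y_def W_def pf_adj_def by (simp_all add: skew6_transpose) (rule eq_matI, auto simp: skew6_def)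
  have tN: "transpose_mat N = Y * Z"
    unfolding N_def transpose_mult[OF Z Y] tZ tY using Z Y by simp
  \<comment> \<open>\<open>S m\<close> is \<open>N^m X\<close>. Since
    \<open>N X = Z = X N^t\<close>, a factor \<open>N\<close> on the left and a factor
    \<open>N^t\<close> on the right both shift the index, which makes the Gram matrix of the new
    basis Hankel. The largest index that occurs is \<open>1 + 2 + 2 = 5\<close>, hence the padding
    by zeros.\<close>
  define S where "S m = [X, Z, Z * (Y * Z), 0\<^sub>m 6 6, 0\<^sub>m 6 6, 0\<^sub>m 6 6] ! m" for m :: nat
  have S: "S m \<in> carrier_mat 6 6" if "m < 6" for m
    using that ZYZ X Z by (elim less6E; simp add: S_def)
  have NS: "N * S m = S (Suc m)" and SN: "S m * transpose_mat N = S (Suc m)" if "m < 5" for m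
  proof -
    from that consider "m = 0" | "m = 1" | "m = 2" | "m = 3" | "m = 4" by linarith
    then show "N * S m = S (Suc m)" 
      by cases (use Z Y X YX XYM Z5 N in \<open>simp_all add: S_def N_def\<close>)
    from that consider "m = 0" | "m = 1" | "m = 2" | "m = 3" | "m = 4" by linarith
    then show "S m * transpose_mat N = S (Suc m)" 
      unfolding tN by cases (use Z Y X YX XYM Z5 N in \<open>simp_all add: S_def\<close>)
  qed
  have Np: "(N ^\<^sub>m p) \<in> carrier_mat 6 6" for p using N by simp
  have NpS: "(N ^\<^sub>m p) * S m = S (m + p)" if "m + p < 6" for p m
    using that
  proof (induction p arbitrary: m)
    case 0
    then show ?case using S[of m] N by simp
  next
    case (Suc p)
    then show ?case using NS[of m] Suc.IH[of "Suc m"] N S[of m] Np[of p] by simp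
  qed
  have SNp: "S m * transpose_mat (N ^\<^sub>m p) = S (m + p)" if "m + p < 6" for p m
    using that
  proof (induction p arbitrary: m)
    case 0
    then show ?case using S[of m] N by simp
  next
    case (Suc p)
    have "transpose_mat N \<in> carrier_mat 6 6" "transpose_mat (N ^\<^sub>m p) \<in> carrier_mat 6 6" using N Np by simp_all
    with Suc show ?case using SN[of m] Suc.IH[of "Suc m"] S[of m] transpose_mult[OF Np[of p] N]
      by (simp flip: assoc_mult_mat[of _ 6 6 _ 6 _ 6])
  qed
  have tS: "transpose_mat (S m) = - S m" if "m < 3" for m
  proof -
    from that consider "m = 0" | "m = 1" | "m = 2" by linarith
    then show ?thesis
    proof cases
      case 3
      have "transpose_mat (Z * (Y * Z)) = - (Z * (Y * Z))"
        unfolding transpose_mult[OF Z mult_carrier_mat[OF Y Z]] transpose_mult[OF Y Z] tZ tY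
        using Z Y by simp
      with 3 show ?thesis by (simp add: S_def)
    qed (simp_all add: S_def X_def Z_def skew6_transpose)
  qed
  \<comment> \<open>Vanishing diagonals make the span of the vectors from row \<open>i\<close>, and
    likewise that from row \<open>j\<close>, isotropic for both forms.\<close>
  have Sd: "S m $$ (n, n) = 0" if "m < 6" "n < 6" for m n
  proof (cases "m < 3")
    case True
    from arg_cong[OF tS[OF True], of "\<lambda>M. M $$ (n, n)"] S[OF that(1)] that show ?thesis by simp
  next
    case False
    with that show ?thesis by (elim less6E; simp add: S_def)
  qed
  define R where "R = mat 6 6 (\<lambda>(r, q). (N ^\<^sub>m (r mod 3)) $$ (if r < 3 then i else j, q))"
  have R: "R \<in> carrier_mat 6 6" by (simp add: R_def)
  have RS: "(R * S m * transpose_mat R) $$ (r, s) = S (m + r mod 3 + s mod 3) $$ (if r < 3 then i else j, if s < 3 then i else j)"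
    if "r < 6" "s < 6" "m < 2" for r s m
  proof -
    let ?i = "if r < 3 then i else j" and ?j = "if s < 3 then i else j" 
    have i: "?i < 6" and j: "?j < 6" using ij by auto
    have "r mod 3 < 3" "s mod 3 < 3" by simp_all
    with \<open>m < 2\<close> have m: "m + r mod 3 + s mod 3 < 6" "m + r mod 3 < 6" by linarith+
    have c: "(N ^\<^sub>m p) * S m \<in> carrier_mat 6 6" for p using Np S[of m] \<open>m < 2\<close> by simp
    have idxT: "(\<Sum>b = 0..<6. M $$ (n, b) * M' $$ (n', b)) = (M * transpose_mat M') $$ (n, n')"
      if "M \<in> carrier_mat 6 6" "M' \<in> carrier_mat 6 6" "n < 6" "n' < 6" for M M' :: "complex mat" and n n'
      using that by (simp add: scalar_prod_def)
    have idx: "(\<Sum>a = 0..<6. M $$ (n, a) * S m $$ (a, b)) = (M * S m) $$ (n, b)"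
      if "M \<in> carrier_mat 6 6" "n < 6" "b < 6" for M n b
      using that S[of m] \<open>m < 2\<close> by (simp add: scalar_prod_def)
    have "(R * S m * transpose_mat R) $$ (r, s) = (\<Sum>a = 0..<6. \<Sum>b = 0..<6. R $$ (r, a) * S m $$ (a, b) * R $$ (s, b))"
      using that S[of m] by (intro mat6_congruence_index R) auto
    also have "\<dots> = (\<Sum>b = 0..<6. (\<Sum>a = 0..<6. (N ^\<^sub>m (r mod 3)) $$ (?i, a) * S m $$ (a, b)) * (N ^\<^sub>m (s mod 3)) $$ (?j, b))"
      using that by (subst sum.swap) (simp add: R_def sum_distrib_right)
    also have "(\<Sum>b = 0..<6. (\<Sum>a = 0..<6. (N ^\<^sub>m (r mod 3)) $$ (?i, a) * S m $$ (a, b)) * (N ^\<^sub>m (s mod 3)) $$ (?j, b)) = (\<Sum>b = 0..<6. ((N ^\<^sub>m (r mod 3)) * S m) $$ (?i, b) * (N ^\<^sub>m (s mod 3)) $$ (?j, b))"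
      using i by (intro sum.cong refl arg_cong2[where f = "(*)"] idx Np) simp_all
    also have "\<dots> = ((N ^\<^sub>m (r mod 3)) * S m * transpose_mat (N ^\<^sub>m (s mod 3))) $$ (?i, ?j)"
      by (rule idxT[OF c Np i j])
    also have "\<dots> = S (m + r mod 3 + s mod 3) $$ (?i, ?j)"
      using m by (simp add: NpS SNp)
    finally show ?thesis .
  qed
  have RX: "R * S m * transpose_mat R = skew6 g"
    if "m < 2" and g: "\<And>r s. r < s \<Longrightarrow> s < 6 \<Longrightarrow> S (m + r mod 3 + s mod 3) $$ (if r < 3 then i else j, if s < 3 then i else j) = g r s" for m g
  proof -
    from \<open>m < 2\<close> have "m = 0 \<or> m = 1" by linarith
    then obtain f where f: "S m = skew6 f" by (auto simp: S_def X_def Z_def)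
    have "(R * S m * transpose_mat R) $$ (r, s) = g r s" if "r < s" "s < 6" for r s
      using RS[of r s m] \<open>m < 2\<close> g[OF that] that by simp
    then show ?thesis
      unfolding f skew6_congruence[OF R] by (intro skew6_eqI) (simp add: skew6_def)
  qed
  let ?s = "\<lambda>m. S m $$ (i, j)"
  have S0: "S m $$ (i', j') = 0" if "3 \<le> m" "m < 6" "i' < 6" "j' < 6" for m i' j'
    using that by (elim less6E[of m]; simp add: S_def)
  have RX0: "R * S 0 * transpose_mat R = skew6 (\<lambda>r q. [[0, 0, 0, ?s 0, ?s 1, ?s 2], [0, 0, 0, ?s 1, ?s 2, 0], [0, 0, 0, ?s 2, 0, 0], replicate 6 0, replicate 6 0] ! r ! q)"
  proof (rule RX)
    fix r s :: nat assume rs: "r < s" "s < 6"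
    then have r: "r < 6" by simp
    show "S (0 + r mod 3 + s mod 3) $$ (if r < 3 then i else j, if s < 3 then i else j) =
      [[0, 0, 0, ?s 0, ?s 1, ?s 2], [0, 0, 0, ?s 1, ?s 2, 0], [0, 0, 0, ?s 2, 0, 0], replicate 6 0, replicate 6 0] ! r ! s"
      by (insert rs ij, rule less6E[OF r]; rule less6E[OF rs(2)]; simp add: Sd S0 numeral_2_eq_2[symmetric])
  qed simp
  have RX1: "R * S 1 * transpose_mat R = skew6 (\<lambda>r q. [[0, 0, 0, ?s 1, ?s 2, 0], [0, 0, 0, ?s 2, 0, 0], replicate 6 0, replicate 6 0, replicate 6 0] ! r ! q)"
  proof (rule RX)
    fix r s :: nat assume rs: "r < s" "s < 6"
    then have r: "r < 6" by simp
    show "S (1 + r mod 3 + s mod 3) $$ (if r < 3 then i else j, if s < 3 then i else j) =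
      [[0, 0, 0, ?s 1, ?s 2, 0], [0, 0, 0, ?s 2, 0, 0], replicate 6 0, replicate 6 0, replicate 6 0] ! r ! s"
      by (insert rs ij, rule less6E[OF r]; rule less6E[OF rs(2)]; simp add: Sd S0 numeral_2_eq_2[symmetric])
  qed simp
  have "?s 2 \<noteq> 0" using ij by (simp add: S_def)
  then obtain P where P: "P \<in> carrier_mat 6 6"
    and "P * (R * S 0 * transpose_mat R) * transpose_mat P = skew6 hx" "P * (R * S 1 * transpose_mat R) * transpose_mat P = skew6 hz"
    unfolding RX0 RX1 by (rule hankel_gram_normalize[of "?s 2" "?s 0" "?s 1"])
  then have "(P * R) * X * transpose_mat (P * R) = skew6 hx" "(P * R) * Z * transpose_mat (P * R) = skew6 hz"
    using R X Z by (simp_all add: S_def transpose_mult[OF P R])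
  with that[of "P * R"] P R show ?thesis
    by (simp add: X_def Z_def)
qed

lemma pfaffian_rep_pencil_normal_form:
  assumes "pfaffian_rep (weierstrass l) A"
  obtains c where "pf_equiv A (pencil hx c hz)" "pfaffian_rep (weierstrass l) (pencil hx c hz)"
proof -
  from assms obtain a b c k where A: "A = pencil a b c" and k: "k \<noteq> 0"
    "\<And>x y z. det (A x y z) = k * (weierstrass l x y z)\<^sup>2"
    by (auto simp: pfaffian_rep_def linear_skew_pencil)
  have *: "(pf6 (\<lambda>i j. x * a i j + y * b i j + z * c i j))\<^sup>2 = k * (weierstrass l x y z)\<^sup>2" for x y z
    using k(2)[of x y z] by (simp add: A det_pencil)
  \<comment> \<open>With \<open>z = 1\<close>, the cubic restricts to \<open>- x^3\<close> on
    \<open>y = 0\<close> and to \<open>y\<close> on \<open>x = 0\<close>; the second restriction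
    records smoothness at \<open>(0, 0, 1)\<close>.\<close>
  have "(pf6 (\<lambda>i j. x * a i j + c i j))\<^sup>2 = k * x ^ 6" for x
    using *[of x 0 1] by (simp add: weierstrass_def power2_eq_square power_numeral_reduce)
  moreover have "(pf6 (\<lambda>i j. y * b i j + c i j))\<^sup>2 = k * y ^ 2" for y
    using *[of 0 y 1] by (simp add: weierstrass_def)
  ultimately obtain P where P: "P \<in> carrier_mat 6 6"
    "P * skew6 a * transpose_mat P = skew6 hx" "P * skew6 c * transpose_mat P = skew6 hz"
    using nilpotent_pencil_normal_form[of a c k b] k(1) by metis
  have "pf_equiv A (pencil hx (\<lambda>i j. bil b (\<lambda>a. P $$ (i, a)) (\<lambda>a. P $$ (j, a))) hz)"
    unfolding A using P congruence_to_hx_det[OF P(1,2)]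
    by (intro pencil_congruence[of P]) (simp_all add: skew6_congruence)
  from that[OF this pfaffian_rep_equiv[OF assms this]] show ?thesis .
qed

section \<open>Reduction of the coefficient of $y$\<close>

text \<open>At \<open>x = 1\<close> the Pfaffian and \<open>- F\<close> are cubics in
  \<open>y\<close> whose coefficients are polynomials in \<open>z\<close>. Both have constant term
  1, which fixes the factor \<open>k\<close> and the sign. The six equations compare the
  coefficients of \<open>y z^2\<close>, \<open>y z\<close>, \<open>y\<close>, \<open>y^2 z\<close>,
  \<open>y^2\<close> and \<open>y^3\<close>.\<close>

lemma pfaffian_rep_pencil_coeffs:
  assumes "pfaffian_rep (weierstrass l) (pencil hx c hz)"
  shows "c 2 5 = - 1" "c 1 5 + c 2 4 = 0" "c 0 5 + c 1 4 + c 2 3 = - (1 + l)"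
    "c 0 4 * c 2 5 + c 1 3 * c 2 5 - c 0 2 * c 4 5 - c 1 2 * c 3 5 - c 1 5 * c 2 3 - c 0 5 * c 2 4 = 0"
    "c 0 1 * c 4 5 + c 0 2 * c 3 5 - c 0 3 * c 2 5 - c 0 4 * c 1 5 + c 1 2 * c 3 4 - c 1 3 * c 2 4
      + c 1 4 * c 2 3 + c 0 5 * c 2 3 + c 0 5 * c 1 4 = l"
    "pf6 c = 0"
proof -
  define q0 q1 where "q0 = c 0 1 * c 4 5 + c 0 2 * c 3 5 - c 0 3 * c 2 5 - c 0 4 * c 1 5 + c 1 2 * c 3 4 - c 1 3 * c 2 4
      + c 1 4 * c 2 3 + c 0 5 * c 2 3 + c 0 5 * c 1 4"
    and "q1 = c 0 4 * c 2 5 + c 1 3 * c 2 5 - c 0 2 * c 4 5 - c 1 2 * c 3 5 - c 1 5 * c 2 3 - c 0 5 * c 2 4"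
  have pf: "pf6 (\<lambda>i j. 1 * hx i j + y * c i j + z * hz i j) = 1 + (c 0 5 + c 1 4 + c 2 3 - (c 1 5 + c 2 4) * z + c 2 5 * z^2) * y
      + (q0 + q1 * z) * y^2 + pf6 c * y^3" for y z
    by (simp add: pf6_def pf4_def hx_def hz_def q0_def q1_def algebra_simps power2_eq_square power3_eq_cube)
  from assms obtain k where k: "\<And>x y z. (pf6 (\<lambda>i j. x * hx i j + y * c i j + z * hz i j))\<^sup>2 = k * (weierstrass l x y z)\<^sup>2"
    by (auto simp: pfaffian_rep_def det_pencil)
  have "k = 1"
    using k[of 1 0 0] pf[of 0 0] by (simp add: weierstrass_def)
  have *: "c 0 5 + c 1 4 + c 2 3 - (c 1 5 + c 2 4) * z + c 2 5 * z^2 = - (1 + l) - z^2 \<and> q0 + q1 * z = l \<and> pf6 c = 0" for z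
  proof -
    have "(1 + (c 0 5 + c 1 4 + c 2 3 - (c 1 5 + c 2 4) * z + c 2 5 * z^2) * y + (q0 + q1 * z) * y^2 + pf6 c * y^3)\<^sup>2
      = (1 + (- (1 + l) - z^2) * y + l * y^2 + 0 * y^3)\<^sup>2" for y
    proof -
      have "weierstrass l 1 y z = - (1 + (- (1 + l) - z^2) * y + l * y^2 + 0 * y^3)"
        by (simp add: weierstrass_def algebra_simps power2_eq_square)
      then show ?thesis
        unfolding pf[symmetric] k \<open>k = 1\<close> by (simp only: power2_minus mult_1)
    qed
    from cubic_square_eq[OF this] show ?thesis by auto
  qed
  have "c 0 5 + c 1 4 + c 2 3 + (- (c 1 5 + c 2 4)) * z + c 2 5 * z^2 + 0 * z^3 = - (1 + l) + 0 * z + (- 1) * z^2 + 0 * z^3" for z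
    using *[of z] by (simp add: algebra_simps)
  note coeffs = cubic_eq_coeffs[OF this]
  show "c 2 5 = - 1" "c 0 5 + c 1 4 + c 2 3 = - (1 + l)" by (fact coeffs)+
  show "c 1 5 + c 2 4 = 0" using coeffs(2) by (simp only: neg_equal_0_iff_equal)
  have "q0 = l" "q1 = 0" "pf6 c = 0" using *[of 0] *[of 1] by simp_all
  then show "c 0 4 * c 2 5 + c 1 3 * c 2 5 - c 0 2 * c 4 5 - c 1 2 * c 3 5 - c 1 5 * c 2 3 - c 0 5 * c 2 4 = 0"
    "c 0 1 * c 4 5 + c 0 2 * c 3 5 - c 0 3 * c 2 5 - c 0 4 * c 1 5 + c 1 2 * c 3 4 - c 1 3 * c 2 4
      + c 1 4 * c 2 3 + c 0 5 * c 2 3 + c 0 5 * c 1 4 = l" "pf6 c = 0"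
    by (simp_all add: q0_def q1_def)
qed

lemma hankel_stabilizer_equiv:
  assumes P: "P \<in> carrier_mat 6 6" and "P * skew6 hx * transpose_mat P = skew6 hx" "P * skew6 hz * transpose_mat P = skew6 hz"
    and "P * skew6 c * transpose_mat P = skew6 c'"
  shows "pf_equiv (pencil hx c hz) (pencil hx c' hz)"
  using assms congruence_to_hx_det[OF P, of hx] by (intro pencil_congruence[of P])

text \<open>
  The element \<open>1 + \<epsilon> u + \<epsilon>\<^sup>2 w\<close> of \<open>SL\<^sub>2(\<complex>[\<epsilon>]/\<epsilon>\<^sup>3)\<close> with \<open>u\<^sub>2\<^sub>2 = - u\<^sub>1\<^sub>1\<close>; its determinant is
  \<open>1\<close> iff \<open>w\<^sub>1\<^sub>1 + w\<^sub>2\<^sub>2 = - det u\<close>.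
\<close>

definition unipotent_rows :: "complex \<Rightarrow> complex \<Rightarrow> complex \<Rightarrow> complex \<Rightarrow> complex \<Rightarrow> complex \<Rightarrow> complex \<Rightarrow> complex list list" where
  "unipotent_rows u11 u12 u21 w11 w12 w21 w22 =
    [[1, u11, w11, 0, u12, w12], [0, 1, u11, 0, 0, u12], [0, 0, 1, 0, 0, 0],
     [0, u21, w21, 1, - u11, w22], [0, 0, u21, 0, 1, - u11], [0, 0, 0, 0, 0, 1]]"

lemma unipotent_equiv:
  fixes u11 u12 u21 w11 w12 w21 w22 :: complex
  assumes "w11 + w22 = u11\<^sup>2 + u12 * u21"
  defines "L \<equiv> unipotent_rows u11 u12 u21 w11 w12 w21 w22"
  shows "pf_equiv (pencil hx c hz) (pencil hx (\<lambda>i j. bil c ((!) (L ! i)) ((!) (L ! j))) hz)"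
proof (rule hankel_stabilizer_equiv)
  have *: "w22 = u11 * u11 + u12 * u21 - w11" 
    using assms(1) by (simp add: power2_eq_square algebra_simps)
  show "mat6 L * skew6 hx * transpose_mat (mat6 L) = skew6 hx"
    unfolding L_def unipotent_rows_def by (rule mat6_congruence; simp add: bil_list hx_def; simp add: * algebra_simps)
  show "mat6 L * skew6 hz * transpose_mat (mat6 L) = skew6 hz"
    unfolding L_def unipotent_rows_def by (rule mat6_congruence; simp add: bil_list hz_def; simp add: * algebra_simps)
  show "mat6 L * skew6 c * transpose_mat (mat6 L) = skew6 (\<lambda>i j. bil c ((!) (L ! i)) ((!) (L ! j)))"
    unfolding L_def unipotent_rows_def by (rule mat6_congruence) simp_all
qed simp

text \<open>The entries \<open>a1\<close>, \<open>a2\<close>, \<open>q\<close>, \<open>- 1\<close>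
  form a symmetric matrix tensored with the alternating form on the plane of \<open>e\<close> and
  \<open>f\<close>, and are fixed by \<open>SL\<^sub>2(\<complex>)\<close>. The entries \<alpha>,
  \<beta>, \<delta> form an alternating matrix tensored with a binary quadratic form on that plane,
  on which the group acts by substitution.\<close>

definition normal_y :: "complex \<Rightarrow> complex \<Rightarrow> complex \<Rightarrow> complex \<Rightarrow> complex \<Rightarrow> complex \<Rightarrow> nat \<Rightarrow> nat \<Rightarrow> complex" where
  "normal_y a1 a2 q \<alpha> \<beta> \<delta> i j =
    [[0, \<alpha>, 0, a1, \<beta>, q], [0, 0, 0, - \<beta>, a2, 0], [0, 0, 0, q, 0, - 1], [0, 0, 0, 0, \<delta>, 0], replicate 6 0] ! i ! j"

lemma reduce_to_normal_y:
  assumes A: "pfaffian_rep (weierstrass l) (pencil hx c hz)"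
  obtains a1 a2 q \<alpha> \<beta> \<delta> where "pf_equiv (pencil hx c hz) (pencil hx (normal_y a1 a2 q \<alpha> \<beta> \<delta>) hz)"
proof -
  \<comment> \<open>First order in \<epsilon>: the pivot \<open>c 2 5 = - 1\<close> clears the
    entries \<open>(1, 2)\<close>, \<open>(1, 5)\<close>, \<open>(2, 4)\<close>,
    \<open>(4, 5)\<close>. With \<open>w22 = 0\<close>, the determinant condition dictates
    \<open>w11\<close>.\<close>
  define L where "L = unipotent_rows (c 1 5) (- c 1 2) (c 4 5) ((c 1 5)\<^sup>2 - c 1 2 * c 4 5) 0 0 0"
  define d where "d = (\<lambda>i j. bil c ((!) (L ! i)) ((!) (L ! j)))"
  have cd: "pf_equiv (pencil hx c hz) (pencil hx d hz)"
    unfolding d_def L_def by (rule unipotent_equiv) simp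
  note B = pfaffian_rep_equiv[OF A cd]
  have [simp]: "c 2 4 = - c 1 5" "c 2 5 = - 1"
    using pfaffian_rep_pencil_coeffs(1,2)[OF A] by (simp_all add: eq_neg_iff_add_eq_0 add.commute)
  have d0: "d 1 2 = 0" "d 1 5 = 0" "d 2 4 = 0" "d 4 5 = 0"
    unfolding d_def L_def unipotent_rows_def by (simp_all add: bil_list)
  have d25: "d 2 5 = - 1" using pfaffian_rep_pencil_coeffs(1)[OF B] .
  \<comment> \<open>Second order in \<epsilon>: the same pivot clears \<open>(0, 2)\<close> and
    \<open>(3, 5)\<close> and equalizes \<open>(0, 5)\<close> and \<open>(2, 3)\<close>. As
    \<open>u = 0\<close>, the earlier zeros survive and \<open>w\<close> has trace 0.\<close>
  define M where "M = unipotent_rows 0 0 0 ((d 0 5 - d 2 3) / 2) (- d 0 2) (d 3 5) (- (d 0 5 - d 2 3) / 2)"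
  define e where "e = (\<lambda>i j. bil d ((!) (M ! i)) ((!) (M ! j)))"
  have de: "pf_equiv (pencil hx d hz) (pencil hx e hz)"
    unfolding e_def M_def by (rule unipotent_equiv) (simp add: field_simps)
  have e0: "e 1 2 = 0" "e 1 5 = 0" "e 2 4 = 0" "e 4 5 = 0" "e 2 5 = - 1" "e 0 2 = 0" "e 3 5 = 0" "e 2 3 = e 0 5"
    unfolding e_def M_def unipotent_rows_def by (simp_all add: bil_list d0[simplified] d25 field_simps)
  from pfaffian_rep_pencil_coeffs(4)[OF pfaffian_rep_equiv[OF B de]]
  have e13: "e 1 3 = - e 0 4" by (simp add: e0[simplified] eq_neg_iff_add_eq_0)
  have "skew6 e = skew6 (normal_y (e 0 3) (e 1 4) (e 0 5) (e 0 1) (e 0 4) (e 3 4))"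
  proof (rule skew6_eqI)
    fix i j :: nat assume ij: "i < j" "j < 6"
    then have i: "i < 6" by simp
    show "e i j = normal_y (e 0 3) (e 1 4) (e 0 5) (e 0 1) (e 0 4) (e 3 4) i j"
      by (insert ij e0 e13, rule less6E[OF i]; rule less6E[OF ij(2)]; simp add: normal_y_def)
  qed
  then have "pencil hx e hz = pencil hx (normal_y (e 0 3) (e 1 4) (e 0 5) (e 0 1) (e 0 4) (e 3 4)) hz"
    by (intro ext) (simp add: pencil_linear)
  moreover have "pf_equiv (pencil hx c hz) (pencil hx e hz)"
    using pf_equiv_trans[OF _ cd de] linear_skew_pencil by blast
  ultimately show ?thesis using that by simp
qed

text \<open>The scalars are those that the Pfaffian forces for \<open>t = - a2\<close>; they form
  the symmetric part of the coefficient of \<open>y\<close> in \<open>Bmat\<close>.\<close>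

definition weierstrass_y :: "complex \<Rightarrow> complex \<Rightarrow> complex \<Rightarrow> complex \<Rightarrow> complex \<Rightarrow> nat \<Rightarrow> nat \<Rightarrow> complex" where
  "weierstrass_y l t = normal_y ((3 * t\<^sup>2 - 2 * t * (1 + l) - (1 - l)\<^sup>2) / 4) (- t) ((t - 1 - l) / 2)"

text \<open>The coefficient of \<open>y\<close> determines \<open>q\<close>, that of
  \<open>y^2\<close> determines \<open>a1\<close>, and that of \<open>y^3\<close> says that the
  discriminant is \<open>t (a1 + q\<^sup>2)\<close>, which factors as stated.\<close>

lemma pfaffian_rep_normal_y:
  assumes "pfaffian_rep (weierstrass l) (pencil hx (normal_y a1 a2 q \<alpha> \<beta> \<delta>) hz)"
  obtains t where "normal_y a1 a2 q \<alpha> \<beta> \<delta> = weierstrass_y l t \<alpha> \<beta> \<delta>"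
    "\<beta>\<^sup>2 - \<alpha> * \<delta> = t * (t - 1) * (t - l)"
proof -
  define t where "t = - a2"
  note C = pfaffian_rep_pencil_coeffs[OF assms]
  have a2: "a2 = - t" by (simp add: t_def)
  have q: "q = (t - 1 - l) / 2"
    using C(3) by (simp add: normal_y_def a2 field_simps)
  have a1: "a1 = l + 2 * t * q - q\<^sup>2"
    using C(5) by (simp add: normal_y_def a2 power2_eq_square algebra_simps)
  have "\<beta>\<^sup>2 - \<alpha> * \<delta> = t * (a1 + q\<^sup>2)"
    using C(6) by (simp add: pf6_def pf4_def normal_y_def a2 power2_eq_square algebra_simps)
  also have "\<dots> = t * (t - 1) * (t - l)"
    unfolding a1 q by (simp add: field_simps power2_eq_square)
  finally have "\<beta>\<^sup>2 - \<alpha> * \<delta> = t * (t - 1) * (t - l)" .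
  moreover have a1': "a1 = (3 * t\<^sup>2 - 2 * t * (1 + l) - (1 - l)\<^sup>2) / 4"
    unfolding a1 q by (simp add: field_simps power2_eq_square)
  moreover have "normal_y a1 a2 q \<alpha> \<beta> \<delta> = weierstrass_y l t \<alpha> \<beta> \<delta>"
    by (simp only: weierstrass_y_def a1' q a2)
  ultimately show ?thesis using that by blast
qed

text \<open>The matrix with rows \<open>(p, q)\<close> and \<open>(r, s)\<close> acts simultaneously
  on the three pairs \<open>(0, 3)\<close>, \<open>(1, 4)\<close>, \<open>(2, 5)\<close>.
  Determinant 1 preserves \<open>hx\<close>, \<open>hz\<close> and the scalar entries.\<close>

lemma sl2_equiv:
  assumes "p * s - q * r = 1"
  shows "pf_equiv (pencil hx (normal_y a1 a2 b \<alpha> \<beta> \<delta>) hz)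
    (pencil hx (normal_y a1 a2 b (p\<^sup>2 * \<alpha> + 2 * p * q * \<beta> + q\<^sup>2 * \<delta>)
       (p * r * \<alpha> + (p * s + q * r) * \<beta> + q * s * \<delta>) (r\<^sup>2 * \<alpha> + 2 * r * s * \<beta> + s\<^sup>2 * \<delta>)) hz)"
proof (rule hankel_stabilizer_equiv)
  define L where "L = [[p, 0, 0, q, 0, 0], [0, p, 0, 0, q, 0], [0, 0, p, 0, 0, q],
     [r, 0, 0, s, 0, 0], [0, r, 0, 0, s, 0], [0, 0, r, 0, 0, s]]"
  have 1: "p * s = 1 + q * r" using assms by (simp add: algebra_simps)
  have 2: "p * (s * x) = x + q * (r * x)" for x
    using arg_cong[OF 1, of "\<lambda>y. y * x"] by (simp add: algebra_simps)
  show "mat6 L * skew6 hx * transpose_mat (mat6 L) = skew6 hx"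
    unfolding L_def by (rule mat6_congruence; simp add: bil_list hx_def; simp add: 1 algebra_simps)
  show "mat6 L * skew6 hz * transpose_mat (mat6 L) = skew6 hz"
    unfolding L_def by (rule mat6_congruence; simp add: bil_list hz_def; simp add: 1 algebra_simps)
  show "mat6 L * skew6 (normal_y a1 a2 b \<alpha> \<beta> \<delta>) * transpose_mat (mat6 L) = skew6 (normal_y a1 a2 b (p\<^sup>2 * \<alpha> + 2 * p * q * \<beta> + q\<^sup>2 * \<delta>)
       (p * r * \<alpha> + (p * s + q * r) * \<beta> + q * s * \<delta>) (r\<^sup>2 * \<alpha> + 2 * r * s * \<beta> + s\<^sup>2 * \<delta>))"
    unfolding L_def by (rule mat6_congruence; simp add: bil_list normal_y_def; simp add: 1 2 power2_eq_square algebra_simps)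
qed simp

text \<open>For nonzero discriminant, \<open>(p, q)\<close> and \<open>(r, s)\<close> are two
  independent isotropic vectors, scaled to determinant 1. A nonzero form of discriminant 0 is the
  square of a linear form: \<open>(r, s)\<close> spans its kernel and \<open>(p, q)\<close> has
  value 1. The zero form falls under the first alternative.\<close>

lemma sl2_normal_form_exists:
  fixes \<alpha> \<beta> \<delta> :: complex
  obtains p q r s where "p * s - q * r = 1" "p\<^sup>2 * \<alpha> + 2 * p * q * \<beta> + q\<^sup>2 * \<delta> = 0" "r\<^sup>2 * \<alpha> + 2 * r * s * \<beta> + s\<^sup>2 * \<delta> = 0"
  | p q r s where "\<beta>\<^sup>2 = \<alpha> * \<delta>" "p * s - q * r = 1" "p\<^sup>2 * \<alpha> + 2 * p * q * \<beta> + q\<^sup>2 * \<delta> = 1" 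
    "p * r * \<alpha> + (p * s + q * r) * \<beta> + q * s * \<delta> = 0" "r\<^sup>2 * \<alpha> + 2 * r * s * \<beta> + s\<^sup>2 * \<delta> = 0"
proof (cases "\<beta>\<^sup>2 = \<alpha> * \<delta>")
  case False
  define d where "d = csqrt (\<beta>\<^sup>2 - \<alpha> * \<delta>)"
  have d: "d\<^sup>2 = \<beta>\<^sup>2 - \<alpha> * \<delta>" "d \<noteq> 0" using False by (simp_all add: d_def)
  show ?thesis
  proof (cases "\<alpha> = 0")
    case True
    with False have "\<beta> \<noteq> 0" by auto
    show ?thesis
      by (rule that(1)[of 1 1 0 "- \<delta> / (2 * \<beta>)"], use True \<open>\<beta> \<noteq> 0\<close> in \<open>simp_all add: field_simps power2_eq_square\<close>) 
  next
    case False
    show ?thesis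
    \<comment> \<open>The instantiation order is \<open>p\<close>, \<open>s\<close>,
      \<open>q\<close>, \<open>r\<close>. The vectors are multiples of
      \<open>(d - \<beta>, \<alpha>)\<close> and \<open>(- \<beta> - d, \<alpha>)\<close>, which
      come from the two roots of the quadratic form.\<close>
    proof (rule that(1)[of "(d - \<beta>) / (2 * d)" 1 "\<alpha> / (2 * d)" "(- \<beta> - d) / \<alpha>"])
      show "(d - \<beta>) / (2 * d) * 1 - \<alpha> / (2 * d) * ((- \<beta> - d) / \<alpha>) = 1"
        using d(2) False by (simp add: field_simps)
      have "(d - \<beta>)\<^sup>2 + 2 * (d - \<beta>) * \<beta> + \<alpha> * \<delta> = 0"
        using d(1) by (simp add: power2_eq_square algebra_simps)
      moreover have "((d - \<beta>) / (2 * d))\<^sup>2 * \<alpha> + 2 * ((d - \<beta>) / (2 * d)) * (\<alpha> / (2 * d)) * \<beta> + (\<alpha> / (2 * d))\<^sup>2 * \<delta>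
          = \<alpha> * ((d - \<beta>)\<^sup>2 + 2 * (d - \<beta>) * \<beta> + \<alpha> * \<delta>) / (2 * d)\<^sup>2"
        using d(2) by (simp add: field_simps power2_eq_square)
      ultimately show "((d - \<beta>) / (2 * d))\<^sup>2 * \<alpha> + 2 * ((d - \<beta>) / (2 * d)) * (\<alpha> / (2 * d)) * \<beta> + (\<alpha> / (2 * d))\<^sup>2 * \<delta> = 0"
        by simp
      have "(- \<beta> - d)\<^sup>2 + 2 * (- \<beta> - d) * \<beta> + \<alpha> * \<delta> = 0"
        using d(1) by (simp add: power2_eq_square algebra_simps)
      moreover have "((- \<beta> - d) / \<alpha>)\<^sup>2 * \<alpha> + 2 * ((- \<beta> - d) / \<alpha>) * 1 * \<beta> + 1\<^sup>2 * \<delta>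
          = ((- \<beta> - d)\<^sup>2 + 2 * (- \<beta> - d) * \<beta> + \<alpha> * \<delta>) / \<alpha>"
        using False by (simp add: field_simps power2_eq_square)
      ultimately show "((- \<beta> - d) / \<alpha>)\<^sup>2 * \<alpha> + 2 * ((- \<beta> - d) / \<alpha>) * 1 * \<beta> + 1\<^sup>2 * \<delta> = 0"
        by simp
    qed
  qed
next
  case True
  show ?thesis
  proof (cases "\<alpha> = 0")
    case False
    define a where "a = csqrt \<alpha>"
    have a: "\<alpha> = a * a" "a \<noteq> 0" using False by (simp_all add: a_def flip: power2_eq_square)
    have "\<delta> * (a * a) = \<beta> * \<beta>" using True a by (simp add: power2_eq_square)
    then show ?thesis 
      using a by (intro that(2)[of "1 / a" a 0 "- \<beta> / a"]) (simp_all add: True field_simps power2_eq_square)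
  next
    case \<alpha>: True
    with True have \<beta>: "\<beta> = 0" by simp
    show ?thesis
    proof (cases "\<delta> = 0")
      case True
      show ?thesis by (rule that(1)[of 1 1 0 0]) (simp_all add: \<alpha> \<beta> True)
    next
      case False
      define a where "a = csqrt \<delta>"
      have a: "\<delta> = a * a" "a \<noteq> 0" using False by (simp_all add: a_def flip: power2_eq_square)
      show ?thesis by (rule that(2)[of 0 0 "1 / a" "- a"]) (simp_all add: \<alpha> \<beta> a field_simps power2_eq_square)
    qed
  qed
qed

section \<open>The classification\<close>

lemma Bmat_index:
  assumes "i < 3" "j < 3"
  shows "Bmat l t s x y z $$ (i, j) =
    [[y * ((3 * t\<^sup>2 - 2 * t * (1 + l) - (1 - l)\<^sup>2) / 4), z + y * s, x + y * ((t - 1 - l) / 2)],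
     [z - y * s, x - y * t, 0],
     [x + y * ((t - 1 - l) / 2), 0, - y]] ! i ! j"
proof -
  from assms have "i = 0 \<or> i = 1 \<or> i = 2" "j = 0 \<or> j = 1 \<or> j = 2" by linarith+
  then show ?thesis
    by (elim disjE) (simp_all add: Bmat_def mat_of_rows_list_def)
qed

lemma Bmat_carrier [simp]: "Bmat l t s x y z \<in> carrier_mat 3 3" "dim_row (Bmat l t s x y z) = 3" "dim_col (Bmat l t s x y z) = 3"
  by (auto simp: Bmat_def mat_of_rows_list_def intro!: carrier_matI)

lemma skew_block_index:
  assumes "B x y z \<in> carrier_mat 3 3" "S x y z \<in> carrier_mat 3 3" "i < 6" "j < 6"
  shows "skew_block S B x y z $$ (i, j) =
    (if i < 3 then if j < 3 then S x y z $$ (i, j) else B x y z $$ (i, j - 3)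
     else if j < 3 then - B x y z $$ (j, i - 3) else 0)"
  using assms by (auto simp: skew_block_def)

text \<open>One computation serves both families, with \<open>\<alpha> = 0\<close> for
  \<open>dec_rep\<close> and \<open>\<alpha> = 1\<close> for \<open>indec_rep\<close>. The zero
  lower right block corresponds to \<open>\<delta> = 0\<close>.\<close>

lemma skew_block_Bmat:
  assumes S: "S x y z = y \<cdot>\<^sub>m (\<alpha> \<cdot>\<^sub>m Emat)"
  shows "skew_block S (Bmat l t s) x y z = pencil hx (weierstrass_y l t \<alpha> s 0) hz x y z" (is "?L = ?R")
proof (rule eq_matI)
  have E: "S x y z \<in> carrier_mat 3 3" by (auto simp: S Emat_def mat_of_rows_list_def intro!: carrier_matI)
  fix i j assume "i < dim_row ?R" "j < dim_col ?R"
  then have i: "i < 6" and j: "j < 6" by (simp_all add: pencil_def)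
  note sb = skew_block_index[of "Bmat l t s" x y z S, OF Bmat_carrier(1) E i j]
  show "?L $$ (i, j) = ?R $$ (i, j)"
    by (subst sb, rule less6E[OF i]; rule less6E[OF j];
      simp add: S Emat_def mat_of_rows_list_def Bmat_index pencil_def skew6_def hx_def hz_def weierstrass_y_def normal_y_def)
qed (simp_all add: skew_block_def pencil_def S Emat_def mat_of_rows_list_def)

lemma dec_rep_pencil: "dec_rep l t s = pencil hx (weierstrass_y l t 0 s 0) hz"
  unfolding dec_rep_def by (intro ext skew_block_Bmat) (rule eq_matI, auto simp: Emat_def mat_of_rows_list_def)

lemma indec_rep_pencil: "indec_rep l t = pencil hx (weierstrass_y l t 1 0 0) hz"
  unfolding indec_rep_def by (intro ext skew_block_Bmat) (rule eq_matI, auto simp: Emat_def mat_of_rows_list_def)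

lemma pfaffian_rep_weierstrass_y:
  assumes "\<beta>\<^sup>2 - \<alpha> * \<delta> = t * (t - 1) * (t - l)"
  shows "pfaffian_rep (weierstrass l) (pencil hx (weierstrass_y l t \<alpha> \<beta> \<delta>) hz)"
proof -
  have "pf6 (\<lambda>i j. x * hx i j + y * weierstrass_y l t \<alpha> \<beta> \<delta> i j + z * hz i j) = - weierstrass l x y z" for x y z
  proof -
    have "pf6 (\<lambda>i j. x * hx i j + y * weierstrass_y l t \<alpha> \<beta> \<delta> i j + z * hz i j)
      = y ^ 3 * (\<beta>\<^sup>2 - \<alpha> * \<delta> - t * (t - 1) * (t - l)) - weierstrass l x y z"
      by (simp add: pf6_def pf4_def hx_def hz_def weierstrass_y_def normal_y_def weierstrass_def field_simps power2_eq_square power3_eq_cube)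
    with assms show ?thesis by simp
  qed
  then have "det (pencil hx (weierstrass_y l t \<alpha> \<beta> \<delta>) hz x y z) = 1 * (weierstrass l x y z)\<^sup>2" for x y z
    by (simp add: det_pencil)
  then show ?thesis
    unfolding pfaffian_rep_def linear_skew_pencil by (metis zero_neq_one)
qed

lemma det_Bmat:
  assumes "s\<^sup>2 = t * (t - 1) * (t - l)"
  shows "det (Bmat l t s x y z) = weierstrass l x y z"
proof -
  have eq: "mat 3 3 = (mat (Suc (Suc (Suc 0))) (Suc (Suc (Suc 0))) :: _ \<Rightarrow> complex mat)"
    by (simp add: numeral_eq_Suc)
  have "Bmat l t s x y z = mat 3 3 (\<lambda>(i, j). [[y * ((3 * t\<^sup>2 - 2 * t * (1 + l) - (1 - l)\<^sup>2) / 4), z + y * s, x + y * ((t - 1 - l) / 2)],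
     [z - y * s, x - y * t, 0],
     [x + y * ((t - 1 - l) / 2), 0, - y]] ! i ! j)"
    by (rule eq_matI) (simp_all add: Bmat_index)
  then have "det (Bmat l t s x y z) = weierstrass l x y z - y ^ 3 * (s\<^sup>2 - t * (t - 1) * (t - l))"
    unfolding eq by (simp only: det_mat_Suc)
      (simp add: lessThan_Suc weierstrass_def field_simps power2_eq_square power3_eq_cube)
  with assms show ?thesis by simp
qed

lemma decomposable_dec_rep:
  assumes s: "s\<^sup>2 = t * (t - 1) * (t - l)"
  shows "decomposable_rep (weierstrass l) (dec_rep l t s)"
proof -
  have p: "pfaffian_rep (weierstrass l) (dec_rep l t s)"
    unfolding dec_rep_pencil by (rule pfaffian_rep_weierstrass_y) (simp add: s)
  have "linear_matrix (carrier_mat 3 3) (Bmat l t s)"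
    unfolding linear_matrix_def
  proof (intro bexI allI)
    fix x y z
    show "Bmat l t s x y z = x \<cdot>\<^sub>m Bmat l t s 1 0 0 + y \<cdot>\<^sub>m Bmat l t s 0 1 0 + z \<cdot>\<^sub>m Bmat l t s 0 0 1"
    proof (rule eq_matI, goal_cases)
      case (1 i j)
      then have ij: "i < 3" "j < 3" by simp_all
      then have "i = 0 \<or> i = 1 \<or> i = 2" "j = 0 \<or> j = 1 \<or> j = 2" by linarith+
      then show ?case by (elim disjE) (simp_all add: Bmat_index algebra_simps)
    qed simp_all
  qed simp_all
  then have "determinantal_rep (weierstrass l) (Bmat l t s)"
    unfolding determinantal_rep_def det_Bmat[OF s] by (metis mult_1 zero_neq_one)
  moreover have "pf_equiv (dec_rep l t s) (skew_block zero_form (Bmat l t s))"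
    using pf_equiv_refl[of "dec_rep l t s"] p unfolding dec_rep_def pfaffian_rep_def by blast
  ultimately show ?thesis using p unfolding decomposable_rep_def by blast
qed

lemma decomposable_rep_equiv:
  assumes "decomposable_rep F A" "pf_equiv A B"
  shows "decomposable_rep F B"
proof -
  have A: "linear_matrix (skew_mats 6) A" and B: "pfaffian_rep F B"
    using assms pfaffian_rep_equiv[of F A B] by (auto simp: decomposable_rep_def pfaffian_rep_def)
  from B have B': "linear_matrix (skew_mats 6) B" by (simp add: pfaffian_rep_def)
  from assms(1) obtain C where C: "determinantal_rep F C" "pf_equiv A (skew_block zero_form C)"
    by (auto simp: decomposable_rep_def)
  have "pf_equiv B (skew_block zero_form C)"
    using pf_equiv_trans[OF B' pf_equiv_sym[OF A assms(2)] C(2)] .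
  with B C(1) show ?thesis by (auto simp: decomposable_rep_def)
qed

lemma pfaffian_rep_classification:
  assumes A: "pfaffian_rep (weierstrass l) A"
  shows "(\<exists>t s. s\<^sup>2 = t * (t - 1) * (t - l) \<and> pf_equiv A (dec_rep l t s)) \<or>
    (\<exists>t\<in>{0, 1, l}. pf_equiv A (indec_rep l t))"
proof -
  have lin: "linear_matrix (skew_mats 6) A" using A by (simp add: pfaffian_rep_def)
  obtain c where c: "pf_equiv A (pencil hx c hz)" "pfaffian_rep (weierstrass l) (pencil hx c hz)"
    using pfaffian_rep_pencil_normal_form[OF A] .
  obtain a1 a2 q \<alpha> \<beta> \<delta> where n: "pf_equiv (pencil hx c hz) (pencil hx (normal_y a1 a2 q \<alpha> \<beta> \<delta>) hz)"
    using reduce_to_normal_y[OF c(2)] .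
  note An = pf_equiv_trans[OF lin c(1) n]
  have sl2: "pf_equiv A (pencil hx (normal_y a1 a2 q \<alpha>' \<beta>' \<delta>') hz)"
    if "p * s - u * r = 1" "\<alpha>' = p\<^sup>2 * \<alpha> + 2 * p * u * \<beta> + u\<^sup>2 * \<delta>" 
      "\<beta>' = p * r * \<alpha> + (p * s + u * r) * \<beta> + u * s * \<delta>" "\<delta>' = r\<^sup>2 * \<alpha> + 2 * r * s * \<beta> + s\<^sup>2 * \<delta>" 
    for p s u r \<alpha>' \<beta>' \<delta>'
    unfolding that(2-) by (rule pf_equiv_trans[OF lin An sl2_equiv[OF that(1)]])
  show ?thesis
  proof (rule sl2_normal_form_exists[of \<alpha> \<beta> \<delta>])
    fix p u r s assume g: "p * s - u * r = 1" "p\<^sup>2 * \<alpha> + 2 * p * u * \<beta> + u\<^sup>2 * \<delta> = 0" "r\<^sup>2 * \<alpha> + 2 * r * s * \<beta> + s\<^sup>2 * \<delta> = 0"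
    define b where "b = p * r * \<alpha> + (p * s + u * r) * \<beta> + u * s * \<delta>"
    have e: "pf_equiv A (pencil hx (normal_y a1 a2 q 0 b 0) hz)"
      by (rule sl2[OF g(1)]) (simp_all add: g b_def)
    obtain t where "normal_y a1 a2 q 0 b 0 = weierstrass_y l t 0 b 0" "b\<^sup>2 - 0 * 0 = t * (t - 1) * (t - l)"
      using pfaffian_rep_normal_y[OF pfaffian_rep_equiv[OF A e]] .
    with e show ?thesis by (auto simp: dec_rep_pencil)
  next
    fix p u r s assume g: "p * s - u * r = 1" "p\<^sup>2 * \<alpha> + 2 * p * u * \<beta> + u\<^sup>2 * \<delta> = 1"
      "p * r * \<alpha> + (p * s + u * r) * \<beta> + u * s * \<delta> = 0" "r\<^sup>2 * \<alpha> + 2 * r * s * \<beta> + s\<^sup>2 * \<delta> = 0"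
    have e: "pf_equiv A (pencil hx (normal_y a1 a2 q 1 0 0) hz)"
      by (rule sl2[OF g(1)]) (simp_all add: g)
    \<comment> \<open>The discriminant of \<open>(1, 0, 0)\<close> is 0, so \<open>t\<close> is a
      root of \<open>t (t - 1) (t - l)\<close>.\<close>
    obtain t where "normal_y a1 a2 q 1 0 0 = weierstrass_y l t 1 0 0" "0\<^sup>2 - 1 * 0 = t * (t - 1) * (t - l)"
      using pfaffian_rep_normal_y[OF pfaffian_rep_equiv[OF A e]] .
    with e show ?thesis by (auto simp: indec_rep_pencil)
  qed
qed

section \<open>Intertwiners, indecomposability and inequivalence\<close>

text \<open>
  Since \<open>hx\<close> squares to \<open>- 1\<close>, the congruences turn into an intertwining relation, which is
  linear in \<open>P\<close>.
\<close>

lemma hankel_intertwiner: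
  fixes e :: complex
  assumes P: "P \<in> carrier_mat 6 6" and e: "e * e = 1"
    and X: "P * skew6 hx * transpose_mat P = e \<cdot>\<^sub>m skew6 hx"
    and Z: "P * M * transpose_mat P = e \<cdot>\<^sub>m M'" "M \<in> carrier_mat 6 6" "M' \<in> carrier_mat 6 6"
  shows "P * (M * skew6 hx) = (M' * skew6 hx) * P"
proof -
  note [simp] = mult_carrier_mat[of _ 6 6 _ 6] assoc_mult_mat[of _ 6 6 _ 6 _ 6]
    mult_smult_distrib[of _ 6 6 _ 6] mult_smult_assoc_mat[of _ 6 6 _ 6]
  define H where "H = skew6 hx"
  have H: "H \<in> carrier_mat 6 6" by (simp add: H_def)
  have T: "transpose_mat P \<in> carrier_mat 6 6" using P by simp
  have ee: "e \<cdot>\<^sub>m (e \<cdot>\<^sub>m N) = N" for N :: "complex mat"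
    by (rule eq_matI) (simp_all add: e flip: mult.assoc)
  have neg: "- e \<cdot>\<^sub>m - N = e \<cdot>\<^sub>m N" for N
    by (rule eq_matI) simp_all
  have HH: "H * H = - (1\<^sub>m 6)"
  proof (rule eq_matI, goal_cases)
    case (1 i j)
    then have i: "i < 6" and j: "j < 6" by simp_all
    have "(H * H) $$ (i, j) = (\<Sum>k = 0..<6. H $$ (i, k) * H $$ (k, j))"
      using i j H by (simp add: scalar_prod_def)
    also have "\<dots> = (- (1\<^sub>m 6)) $$ (i, j)"
      unfolding sum_upto6 by (rule less6E[OF i]; rule less6E[OF j]; simp add: H_def skew6_def hx_def)
    finally show ?case .
  qed (use H in auto)
  have HHN: "H * (H * N) = - N" if N: "N \<in> carrier_mat 6 6" for N
    using N H left_mult_one_mat[OF N] by (simp add: HH flip: assoc_mult_mat[OF H H N])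
  have "P * (H * transpose_mat P) = e \<cdot>\<^sub>m H"
    using X P H T by (simp add: H_def)
  moreover have "P * (H * (transpose_mat P * H)) = (P * (H * transpose_mat P)) * H"
    using P H T by simp
  ultimately have "P * (H * (transpose_mat P * H)) = e \<cdot>\<^sub>m (H * H)"
    using mult_smult_assoc_mat[OF H H] by simp
  \<comment> \<open>This exhibits the inverse of \<open>P\<close>. Multiplying by it on the other
    side gives \<open>P^t H P = e H\<close>, the relation that moves \<open>P\<close> past
    \<open>H\<close> at the end.\<close>
  then have 1: "P * (- e \<cdot>\<^sub>m (H * (transpose_mat P * H))) = 1\<^sub>m 6"
    using P H T e by (simp add: HH) (rule eq_matI, auto)
  have "(- e \<cdot>\<^sub>m (H * (transpose_mat P * H))) * P = 1\<^sub>m 6"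
    by (rule mat_mult_left_right_inverse[OF P _ 1]) (use P H T in simp)
  then have "- e \<cdot>\<^sub>m (H * (transpose_mat P * (H * P))) = 1\<^sub>m 6"
    using P H T by simp
  then have "H * (- e \<cdot>\<^sub>m (H * (transpose_mat P * (H * P)))) = H"
    using H by simp
  then have "- e \<cdot>\<^sub>m (H * (H * (transpose_mat P * (H * P)))) = H"
    using P H T by simp
  then have "e \<cdot>\<^sub>m (transpose_mat P * (H * P)) = H"
    using P H T by (simp add: HHN neg)
  then have PHP: "e \<cdot>\<^sub>m H = transpose_mat P * (H * P)"
    using ee by metis
  have "M' = e \<cdot>\<^sub>m (P * (M * transpose_mat P))"
    using Z P T ee[of M'] by simp
  then have "M' * (H * P) = e \<cdot>\<^sub>m (P * (M * (transpose_mat P * (H * P))))"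
    using Z P T H by simp
  also have "\<dots> = P * (M * H)"
    unfolding PHP[symmetric] using Z P H by (simp add: ee)
  finally show ?thesis using Z P H by (simp add: H_def)
qed

lemma skew6_mult_hx:
  "skew6 f * skew6 hx = mat6
    [[- f 0 5, - f 0 4, - f 0 3, f 0 2, f 0 1, 0],
     [- f 1 5, - f 1 4, - f 1 3, f 1 2, 0, - f 0 1],
     [- f 2 5, - f 2 4, - f 2 3, 0, - f 1 2, - f 0 2],
     [- f 3 5, - f 3 4, 0, - f 2 3, - f 1 3, - f 0 3],
     [- f 4 5, 0, f 3 4, - f 2 4, - f 1 4, - f 0 4],
     [0, f 4 5, f 3 5, - f 2 5, - f 1 5, - f 0 5]]" (is "_ = ?R")
proof (rule eq_matI, goal_cases)
  case (1 i j)
  then have i: "i < 6" and j: "j < 6" by simp_all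
  have "(skew6 f * skew6 hx) $$ (i, j) = (\<Sum>k = 0..<6. skew6 f $$ (i, k) * skew6 hx $$ (k, j))"
    using i j by (simp add: scalar_prod_def)
  also have "\<dots> = ?R $$ (i, j)"
    unfolding sum_upto6 by (rule less6E[OF i]; rule less6E[OF j]; simp add: skew6_def hx_def mat6_index)
  finally show ?case .
qed simp_all

lemma hz_mult_hx:
  "skew6 hz * skew6 hx = mat6 [[0, - 1, 0, 0, 0, 0], [0, 0, - 1, 0, 0, 0], [0, 0, 0, 0, 0, 0],
     [0, 0, 0, 0, - 1, 0], [0, 0, 0, 0, 0, - 1], [0, 0, 0, 0, 0, 0]]"
  by (simp add: skew6_mult_hx hz_def)

lemma normal_y_mult_hx:
  "skew6 (normal_y a1 a2 q \<alpha> \<beta> \<delta>) * skew6 hx = mat6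
    [[- q, - \<beta>, - a1, 0, \<alpha>, 0], [0, - a2, \<beta>, 0, 0, - \<alpha>], [1, 0, - q, 0, 0, 0],
     [0, - \<delta>, 0, - q, \<beta>, - a1], [0, 0, \<delta>, 0, - a2, - \<beta>], [0, 0, 0, 1, 0, - q]]"
  by (simp add: skew6_mult_hx normal_y_def)

text \<open>The product of \<open>skew6 hz\<close> and \<open>skew6 hx\<close> is minus a shift on
  each triple of indices, so \<open>N\<close> makes the four blocks of \<open>P\<close> upper
  triangular Toeplitz, that is, polynomials in \<epsilon>. The relations from \<open>D\<close> then
  kill the first-order terms of the two upper blocks and constrain the constant terms
  \<open>P $$ (2, 2)\<close>, \<open>P $$ (2, 5)\<close>, \<open>P $$ (5, 2)\<close>,
  \<open>P $$ (5, 5)\<close>.\<close>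

lemma normal_y_intertwiner_entries:
  assumes P: "P \<in> carrier_mat 6 6"
    and N: "P * (skew6 hz * skew6 hx) = (skew6 hz * skew6 hx) * P"
    and D: "P * (skew6 (normal_y a1 a2 q \<alpha> \<beta> \<delta>) * skew6 hx) = (skew6 (normal_y a1' a2' q' \<alpha>' \<beta>' \<delta>') * skew6 hx) * P"
  shows "P $$ (2, 0) = 0" "P $$ (2, 1) = 0" "P $$ (2, 3) = 0" "P $$ (2, 4) = 0"
    "a2 * P $$ (2, 2) = a2' * P $$ (2, 2)" "a2 * P $$ (2, 5) = a2' * P $$ (2, 5)"
    "\<beta> * P $$ (2, 2) + \<delta> * P $$ (2, 5) = \<beta>' * P $$ (2, 2) - \<alpha>' * P $$ (5, 2)"
    "\<alpha> * P $$ (2, 2) + \<beta> * P $$ (2, 5) = \<alpha>' * P $$ (5, 5) - \<beta>' * P $$ (2, 5)"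
    "P $$ (3, 0) = P $$ (5, 2)" "P $$ (3, 3) = P $$ (5, 5)"
proof -
  have entry: "(\<Sum>k = 0..<6. P $$ (i, k) * (mat6 L $$ (k, j))) = (\<Sum>k = 0..<6. mat6 L' $$ (i, k) * P $$ (k, j))"
    if "P * mat6 L = mat6 L' * P" "i < 6" "j < 6" for L L' i j
    using arg_cong[OF that(1), of "\<lambda>M. M $$ (i, j)"] that(2,3) P by (simp add: scalar_prod_def)
  note n = entry[OF N[unfolded hz_mult_hx], unfolded sum_upto6]
  note d = entry[OF D[unfolded normal_y_mult_hx], unfolded sum_upto6]
  have p2: "P $$ (2, 0) = 0" "P $$ (2, 1) = 0" "P $$ (2, 3) = 0" "P $$ (2, 4) = 0"
    using n[of 2 1] n[of 2 2] n[of 2 4] n[of 2 5] by (simp_all add: mat6_index)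
  have p5: "P $$ (5, 0) = 0" "P $$ (5, 1) = 0" "P $$ (5, 3) = 0" "P $$ (5, 4) = 0"
    using n[of 5 1] n[of 5 2] n[of 5 4] n[of 5 5] by (simp_all add: mat6_index)
  have p1: "P $$ (1, 0) = 0" "P $$ (1, 1) = P $$ (2, 2)" "P $$ (1, 3) = 0" "P $$ (1, 4) = P $$ (2, 5)"
    using n[of 1 1] n[of 1 2] n[of 1 4] n[of 1 5] p2 by (simp_all add: mat6_index)
  have p4: "P $$ (4, 0) = 0" "P $$ (4, 1) = P $$ (5, 2)" "P $$ (4, 3) = 0" "P $$ (4, 4) = P $$ (5, 5)"
    using n[of 4 1] n[of 4 2] n[of 4 4] n[of 4 5] p5 by (simp_all add: mat6_index)
  have p0: "P $$ (0, 1) = P $$ (1, 2)" "P $$ (0, 4) = P $$ (1, 5)"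
    using n[of 0 2] n[of 0 5] by (simp_all add: mat6_index)
  have p3: "P $$ (3, 0) = P $$ (5, 2)" "P $$ (3, 3) = P $$ (5, 5)"
    using n[of 3 1] n[of 3 4] p4 by (simp_all add: mat6_index)
  have p01: "P $$ (1, 2) = 0" "P $$ (1, 5) = 0"
    using d[of 2 1] d[of 2 4] p2 p0 p5 by (simp_all add: mat6_index)
  show "P $$ (2, 0) = 0" "P $$ (2, 1) = 0" "P $$ (2, 3) = 0" "P $$ (2, 4) = 0"
    "P $$ (3, 0) = P $$ (5, 2)" "P $$ (3, 3) = P $$ (5, 5)"
    by (fact p2 p3)+
  have "P $$ (2, 2) * a2 = a2' * P $$ (2, 2)" "P $$ (2, 5) * a2 = a2' * P $$ (2, 5)"
    using d[of 1 1] d[of 1 4] by (simp_all add: mat6_index p1[simplified] p2[simplified] p01[simplified] p5[simplified])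
  then show "a2 * P $$ (2, 2) = a2' * P $$ (2, 2)" "a2 * P $$ (2, 5) = a2' * P $$ (2, 5)"
    by (simp_all only: mult.commute[of a2])
  have "P $$ (2, 2) * \<beta> + P $$ (2, 5) * \<delta> = \<beta>' * P $$ (2, 2) - \<alpha>' * P $$ (5, 2)"
    using d[of 1 2] by (simp add: mat6_index p1[simplified] p2[simplified] p01[simplified] p5[simplified])
  then show "\<beta> * P $$ (2, 2) + \<delta> * P $$ (2, 5) = \<beta>' * P $$ (2, 2) - \<alpha>' * P $$ (5, 2)"
    by (simp add: mult_ac)
  have "- (P $$ (2, 2) * \<alpha>) - P $$ (2, 5) * \<beta> = \<beta>' * P $$ (2, 5) - \<alpha>' * P $$ (5, 5)"
    using d[of 1 5] by (simp add: mat6_index p1[simplified] p2[simplified] p01[simplified] p5[simplified])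
  moreover have "\<alpha> * P $$ (2, 2) + \<beta> * P $$ (2, 5) = - (- (P $$ (2, 2) * \<alpha>) - P $$ (2, 5) * \<beta>)"
    by (simp add: mult_ac)
  ultimately show "\<alpha> * P $$ (2, 2) + \<beta> * P $$ (2, 5) = \<alpha>' * P $$ (5, 5) - \<beta>' * P $$ (2, 5)"
    by simp
qed

text \<open>The sign \<open>e = 1\<close> covers equivalences, and \<open>e = - 1\<close> covers the
  involution of a decomposable representation. For the form \<open>(1, 0, 0)\<close> the constant
  term of \<open>P\<close> is triangular with equal diagonal entries; preserving \<open>hx\<close>
  up to \<open>e\<close> makes the square of that entry \<open>e\<close>. As the entry is nonzero,
  it can be cancelled from the relation between the two parameters.\<close>

lemma indec_rep_intertwiner:
  assumes P: "P \<in> carrier_mat 6 6" and e: "e * e = 1"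
    and A: "\<And>x y z. P * indec_rep l t x y z * transpose_mat P = e \<cdot>\<^sub>m indec_rep l t' x y z"
  shows "t = t'" "P $$ (2, 0) = 0" "P $$ (2, 1) = 0" "P $$ (2, 3) = 0" "P $$ (2, 4) = 0"
    "P $$ (5, 2) = 0" "P $$ (2, 2) * P $$ (2, 2) = e"
proof -
  have at: "indec_rep l u 1 0 0 = skew6 hx" "indec_rep l u 0 1 0 = skew6 (weierstrass_y l u 1 0 0)"
    "indec_rep l u 0 0 1 = skew6 hz" for u
    by (simp_all add: indec_rep_pencil pencil_def)
  note X = A[of 1 0 0, unfolded at] and Y = A[of 0 1 0, unfolded at] and Z = A[of 0 0 1, unfolded at]
  note N = hankel_intertwiner[OF P e X Z skew6_carrier(1) skew6_carrier(1)]
  note D = hankel_intertwiner[OF P e X Y skew6_carrier(1) skew6_carrier(1)]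
  note c = normal_y_intertwiner_entries[OF P N D[unfolded weierstrass_y_def]]
  show p2: "P $$ (2, 0) = 0" "P $$ (2, 1) = 0" "P $$ (2, 3) = 0" "P $$ (2, 4) = 0"
    by (fact c)+
  show p52: "P $$ (5, 2) = 0" using c(7) by simp
  have "P $$ (2, 2) = P $$ (5, 5)" using c(8) by simp
  moreover have "P $$ (2, 2) * P $$ (3, 3) - P $$ (2, 5) * P $$ (3, 0) = e"
    using mat6_congruence_index[OF P skew6_carrier(1), of 2 3 hx] p2
    unfolding X sum_upto6 by (simp add: skew6_def hx_def)
  ultimately show sq: "P $$ (2, 2) * P $$ (2, 2) = e"
    using c(9,10) p52 by simp
  with e have "P $$ (2, 2) \<noteq> 0" by auto
  with c(5) show "t = t'" by simp
qed

lemma indec_rep_inj: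
  assumes "pf_equiv (indec_rep l t) (indec_rep l t')"
  shows "t = t'"
proof -
  from assms obtain P where P: "P \<in> carrier_mat 6 6"
    and A: "\<And>x y z. indec_rep l t' x y z = P * indec_rep l t x y z * transpose_mat P"
    by (auto simp: pf_equiv_def)
  have "P * indec_rep l t x y z * transpose_mat P = 1 \<cdot>\<^sub>m indec_rep l t' x y z" for x y z
    unfolding A[symmetric] by (rule eq_matI) simp_all
  then show ?thesis by (rule indec_rep_intertwiner(1)[OF P, of 1, simplified])
qed

text \<open>Congruence by \<open>diag(1, 1, 1, -1, -1, -1)\<close> negates a matrix with zero
  diagonal blocks. Conjugating this diagonal matrix by the equivalence transports it to
  \<open>A\<close>.\<close>

lemma decomposable_rep_involution:
  assumes "decomposable_rep F A"
  obtains P where "P \<in> carrier_mat 6 6" "P * P = 1\<^sub>m 6"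
    "\<And>x y z. P * A x y z * transpose_mat P = - 1 \<cdot>\<^sub>m A x y z"
proof -
  note [simp] = mult_carrier_mat[of _ 6 6 _ 6] assoc_mult_mat[of _ 6 6 _ 6 _ 6]
  from assms obtain B where lin: "linear_matrix (skew_mats 6) A" and B: "determinantal_rep F B"
    and AB: "pf_equiv A (skew_block zero_form B)"
    by (auto simp: decomposable_rep_def pfaffian_rep_def)
  define M where "M = skew_block zero_form B"
  from B have Bc: "B x y z \<in> carrier_mat 3 3" for x y z
    by (auto simp: determinantal_rep_def linear_matrix_def)
  then have Mc: "M x y z \<in> carrier_mat 6 6" for x y z
    using four_block_carrier_mat[of "0\<^sub>m 3 3" 3 3 "0\<^sub>m 3 3" 3 3] by (simp add: M_def skew_block_def)
  from pf_equiv_sym[OF lin AB] obtain R where R: "R \<in> carrier_mat 6 6" "det R \<noteq> 0"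
    and A: "\<And>x y z. A x y z = R * M x y z * transpose_mat R"
    by (auto simp: pf_equiv_def invertible_mat_iff_det M_def)
  from det_non_zero_imp_unit[OF R, of undefined] obtain S where
    S: "S \<in> carrier_mat 6 6" "S * R = 1\<^sub>m 6" "R * S = 1\<^sub>m 6"
    by (auto simp: Units_def ring_mat_def)
  have SRN: "S * (R * N) = N" if N: "N \<in> carrier_mat 6 6" for N
    using left_mult_one_mat[OF N] S(2) by (simp add: assoc_mult_mat[OF S(1) R(1) N, symmetric] del: assoc_mult_mat)
  define D where "D = mat 6 6 (\<lambda>(i, j). if i = j then if i < 3 then 1 else - 1 else (0 :: complex))"
  have D: "D \<in> carrier_mat 6 6" by (simp add: D_def)
  have DD: "D * D = 1\<^sub>m 6"
  proof (rule eq_matI, goal_cases)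
    case (1 i j)
    then have "(D * D) $$ (i, j) = (\<Sum>k = 0..<6. D $$ (i, k) * D $$ (k, j))"
      using D by (simp add: scalar_prod_def)
    also have "\<dots> = (\<Sum>k = 0..<6. if k = i then if i = j then 1 else 0 else 0)"
      using 1 by (intro sum.cong refl) (auto simp: D_def)
    finally show ?case using 1 by simp
  qed (use D in auto)
  have DMD: "D * M x y z * transpose_mat D = - M x y z" for x y z
  proof (rule eq_matI, goal_cases)
    case (1 i j)
    then have ij: "i < 6" "j < 6" using Mc[of x y z] by auto
    have "(D * M x y z * transpose_mat D) $$ (i, j) = (\<Sum>a = 0..<6. \<Sum>b = 0..<6. D $$ (i, a) * M x y z $$ (a, b) * D $$ (j, b))"
      by (rule mat6_congruence_index[OF D Mc ij])
    also have "\<dots> = (\<Sum>a = 0..<6. \<Sum>b = 0..<6. if b = j then D $$ (i, a) * M x y z $$ (a, j) * D $$ (j, j) else 0)"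
      using ij by (intro sum.cong refl) (auto simp: D_def)
    also have "\<dots> = (\<Sum>a = 0..<6. if a = i then D $$ (i, i) * M x y z $$ (i, j) * D $$ (j, j) else 0)"
      using ij by (intro sum.cong refl) (auto simp: D_def)
    also have "\<dots> = D $$ (i, i) * M x y z $$ (i, j) * D $$ (j, j)"
      using ij by simp
    also have "\<dots> = - M x y z $$ (i, j)"
      using ij skew_block_index[of B x y z zero_form, OF Bc _ ij] by (auto simp: D_def M_def)
    finally show ?case using ij Mc[of x y z] by simp
  qed (use D Mc[of x y z] in auto)
  define P where "P = R * (D * S)"
  have P: "P \<in> carrier_mat 6 6" using R S D by (simp add: P_def)
  have "D * (D * S) = S"
    using left_mult_one_mat[OF S(1)] DD by (simp add: assoc_mult_mat[OF D D S(1), symmetric] del: assoc_mult_mat)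
  then have "P * P = 1\<^sub>m 6"
    using R S D by (simp add: P_def SRN)
  moreover have "P * A x y z * transpose_mat P = - 1 \<cdot>\<^sub>m A x y z" for x y z
  proof -
    let ?M = "M x y z"
    have PR: "P * R = R * D" using R S D right_mult_one_mat[OF D] by (simp add: P_def)
    have "P * A x y z * transpose_mat P = (P * R) * ?M * transpose_mat (P * R)"
      using P R Mc[of x y z] unfolding A transpose_mult[OF P R(1)] by simp
    also have "\<dots> = R * (D * ?M * transpose_mat D) * transpose_mat R"
      using D R Mc[of x y z] unfolding PR transpose_mult[OF R(1) D] by simp
    also have "\<dots> = - 1 \<cdot>\<^sub>m A x y z"
      unfolding DMD A using R Mc[of x y z] by simp (rule eq_matI, auto)
    finally show ?thesis .
  qed
  ultimately show ?thesis using that[OF P] by blast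
qed

text \<open>For the involution, \<open>P $$ (2, 2)\<close> squares to \<open>- 1\<close>. The zeros
  in row 2 and at \<open>(5, 2)\<close> leave only this square in the entry \<open>(2, 2)\<close> of
  \<open>P * P\<close>, which should be 1.\<close>

lemma indec_rep_not_decomposable: "\<not> decomposable_rep F (indec_rep l t)"
proof
  assume "decomposable_rep F (indec_rep l t)"
  from decomposable_rep_involution[OF this] obtain P where P: "P \<in> carrier_mat 6 6" "P * P = 1\<^sub>m 6"
    and A: "\<And>x y z. P * indec_rep l t x y z * transpose_mat P = - 1 \<cdot>\<^sub>m indec_rep l t x y z"
    by blast
  note c = indec_rep_intertwiner(2-)[OF P(1) _ A, simplified]
  have "(P * P) $$ (2, 2) = (\<Sum>k = 0..<6. P $$ (2, k) * P $$ (k, 2))"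
    using P(1) by (simp add: scalar_prod_def)
  then show False
    unfolding P(2) sum_upto6 using c by simp
qed

theorem theorem3p2:
  fixes l :: complex
  assumes "l \<noteq> 0" and "l \<noteq> 1"
  shows
    "(\<forall>t \<in> {0, 1, l}. indecomposable_rep (weierstrass l) (indec_rep l t)) \<and>
     (\<forall>t \<in> {0, 1, l}. \<forall>t' \<in> {0, 1, l}.
        t \<noteq> t' \<longrightarrow> \<not> pf_equiv (indec_rep l t) (indec_rep l t')) \<and>
     (\<forall>A. indecomposable_rep (weierstrass l) A \<longrightarrow>
        (\<exists>t \<in> {0, 1, l}. pf_equiv A (indec_rep l t))) \<and>
     (\<forall>t s. s\<^sup>2 = t * (t - 1) * (t - l) \<longrightarrow>
        decomposable_rep (weierstrass l) (dec_rep l t s)) \<and>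
     (\<forall>A. decomposable_rep (weierstrass l) A \<longrightarrow>
        (\<exists>t s. s\<^sup>2 = t * (t - 1) * (t - l) \<and> pf_equiv A (dec_rep l t s)))"
proof (intro conjI ballI allI impI)
  show indec: "indecomposable_rep (weierstrass l) (indec_rep l t)" if "t \<in> {0, 1, l}" for t
    unfolding indecomposable_rep_def
  proof
    show "pfaffian_rep (weierstrass l) (indec_rep l t)"
      unfolding indec_rep_pencil using that by (intro pfaffian_rep_weierstrass_y) auto
  qed (rule indec_rep_not_decomposable)
  show "\<not> pf_equiv (indec_rep l t) (indec_rep l t')" if "t \<noteq> t'" for t t'
    using indec_rep_inj that by blast
  show dec: "decomposable_rep (weierstrass l) (dec_rep l t s)" if "s\<^sup>2 = t * (t - 1) * (t - l)" for t s
    using that by (rule decomposable_dec_rep)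
  show "\<exists>t\<in>{0, 1, l}. pf_equiv A (indec_rep l t)" if A: "indecomposable_rep (weierstrass l) A" for A
  proof -
    from A have p: "pfaffian_rep (weierstrass l) A" and nd: "\<not> decomposable_rep (weierstrass l) A"
      by (simp_all add: indecomposable_rep_def)
    \<comment> \<open>Decomposability is invariant under equivalence, so only the second alternative
      of the classification remains.\<close>
    have "\<not> pf_equiv A (dec_rep l t s)" if "s\<^sup>2 = t * (t - 1) * (t - l)" for t s
      using decomposable_rep_equiv[OF dec[OF that] pf_equiv_sym] p nd by (auto simp: pfaffian_rep_def)
    with pfaffian_rep_classification[OF p] show ?thesis by blast
  qed
  show "\<exists>t s. s\<^sup>2 = t * (t - 1) * (t - l) \<and> pf_equiv A (dec_rep l t s)"
    if A: "decomposable_rep (weierstrass l) A" for A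
  proof -
    from A have "pfaffian_rep (weierstrass l) A"
      by (simp add: decomposable_rep_def)
    moreover have "\<not> pf_equiv A (indec_rep l t)" for t
      using decomposable_rep_equiv[OF A] indec_rep_not_decomposable by blast
    ultimately show ?thesis
      using pfaffian_rep_classification by blast
  qed
qed

end
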